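(* Let $1\leq p\leq 2$ and let $T$ be a weighted bilateral shift on $\ell_p(\mathbb{Z})$. Then the following statements are equivalent: (C1) $T$ satisfies the Supercyclicity Criterion; (C2) $T$ is supercyclic; (C3) $T$ is weakly supercyclic; (C4) $T\oplus T$ is cyclic; (C5) there is an integer $n\geq 2$ for which $T^n$ is cyclic; (C6) for any $n\in\mathbb{N}$, $T^n$ is cyclic.
   Context: All vector spaces are over $\mathbb{C}$; $\mathbb{Z}_+$ is the set of non-negative integers, $\mathbb{N}$ the set of positive integers. A weighted bilateral shift on $\ell_p(\mathbb{Z})$, $1\leq p<\infty$, is the bounded linear operator $T=T_{w,p}$ defined on the canonical basis $\{e_n\}_{n\in\mathbb{Z}}$ by $Te_n=w_ne_{n-1}$ for $n\in\mathbb{Z}$, where $w=\{w_n\}_{n\in\mathbb{Z}}\in\ell_\infty(\mathbb{Z})$ is a bounded sequence of complex numbers with $w_n\neq 0$ for every $n$. For a bounded linear operator $T$ on a Banach space $\mathcal{B}$: - $T$ is cyclic if there is $x\in\mathcal{B}$ such that the linear span of $\{T^nx:n\in\mathbb{Z}_+\}$ is dense in $\mathcal{B}$. - $T$ is supercyclic if there is $x\in\mathcal{B}$ such that $\{\lambda T^nx:\lambda\in\mathbb{C},\ n\in\mathbb{Z}_+\}$ is norm dense in $\mathcal{B}$; weakly supercyclic if there is $x\in\mathcal{B}$ such that this set is dense in $\mathcal{B}$ with respect to the weak topology. - $T$ satisfies the Supercyclicity Criterion if there exist a strictly increasing sequence $\{n_k\}_{k\in\mathbb{Z}_+}$ of positive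 integers, dense subsets $E$ and $F$ of $\mathcal{B}$ and a map $S:F\to F$ such that $TSy=y$ for each $y\in F$ and $\|T^{n_k}x\|\,\|S^{n_k}y\|\to 0$ as $k\to\infty$ for any $x\in E$ and $y\in F$. $T\oplus T$ acts on $\mathcal{B}\oplus\mathcal{B}$ by $(x,y)\mapsto(Tx,Ty)$. *)

theory Defs
  imports "HOL-Analysis.Analysis" "HOL-Library.Function_Algebras"
begin

section \<open>Complex normed spaces with explicit carrier\<close>

text \<open>
  The exponent of a sequence space is a real parameter, so its elements cannot form a type.
  Normed spaces are therefore subspaces (carriers) of an ambient type, which supplies the
  addition, together with a scalar multiplication and a norm.
\<close>

record 'a cnspace =
  vecs :: "'a set"
  scl :: "complex \<Rightarrow> 'a \<Rightarrow> 'a"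
  nrm :: "'a \<Rightarrow> real"

locale complex_normed_space =
  fixes B :: "'a::ab_group_add cnspace"
  assumes vector_space: "vector_space (scl B)"
    and subspace: "module.subspace (scl B) (vecs B)"
    and nrm_nonneg: "0 \<le> nrm B x"
    and nrm_eq_0: "x \<in> vecs B \<Longrightarrow> nrm B x = 0 \<longleftrightarrow> x = 0"
    and nrm_scl: "x \<in> vecs B \<Longrightarrow> nrm B (scl B c x) = cmod c * nrm B x"
    and nrm_minus: "nrm B (- x) = nrm B x"
    and nrm_triangle: "x \<in> vecs B \<Longrightarrow> y \<in> vecs B \<Longrightarrow> nrm B (x + y) \<le> nrm B x + nrm B y"

definition bounded_clinear ::
  "'a::ab_group_add cnspace \<Rightarrow> 'b::ab_group_add cnspace \<Rightarrow> ('a \<Rightarrow> 'b) \<Rightarrow> bool" where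
  "bounded_clinear B C f \<longleftrightarrow>
     f ` vecs B \<subseteq> vecs C \<and>
     (\<forall>x\<in>vecs B. \<forall>y\<in>vecs B. f (x + y) = f x + f y) \<and>
     (\<forall>c. \<forall>x\<in>vecs B. f (scl B c x) = scl C c (f x)) \<and>
     (\<exists>K. \<forall>x\<in>vecs B. nrm C (f x) \<le> K * nrm B x)"

definition scalars :: "complex cnspace" where
  "scalars = \<lparr>vecs = UNIV, scl = (*), nrm = cmod\<rparr>"

definition norm_topology :: "'a::ab_group_add cnspace \<Rightarrow> 'a topology" where
  "norm_topology B = Metric_space.mtopology (vecs B) (\<lambda>x y. nrm B (x - y))"

definition weak_topology :: "'a::ab_group_add cnspace \<Rightarrow> 'a topology" where
  "weak_topology B =
     topology_generated_by {{x \<in> vecs B. f x \<in> U} | f U. bounded_clinear B scalars f \<and> open U}"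

text \<open>
  The sum norm is one of the equivalent norms inducing the product topology; cyclicity
  depends on the topology only.
\<close>

definition direct_sum ::
  "'a::ab_group_add cnspace \<Rightarrow> 'b::ab_group_add cnspace \<Rightarrow> ('a \<times> 'b) cnspace" where
  "direct_sum B C =
     \<lparr>vecs = vecs B \<times> vecs C,
      scl = (\<lambda>c (x, y). (scl B c x, scl C c y)),
      nrm = (\<lambda>(x, y). nrm B x + nrm C y)\<rparr>"

section \<open>Cyclicity and supercyclicity\<close>

definition norm_dense :: "'a::ab_group_add cnspace \<Rightarrow> 'a set \<Rightarrow> bool" where
  "norm_dense B S \<longleftrightarrow> S \<subseteq> vecs B \<and> norm_topology B closure_of S = vecs B"

definition weakly_dense :: "'a::ab_group_add cnspace \<Rightarrow> 'a set \<Rightarrow> bool" where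
  "weakly_dense B S \<longleftrightarrow> S \<subseteq> vecs B \<and> weak_topology B closure_of S = vecs B"

definition cyclic :: "'a::ab_group_add cnspace \<Rightarrow> ('a \<Rightarrow> 'a) \<Rightarrow> bool" where
  "cyclic B T \<longleftrightarrow> (\<exists>x\<in>vecs B. norm_dense B (module.span (scl B) {(T ^^ n) x | n. True}))"

definition supercyclic :: "'a::ab_group_add cnspace \<Rightarrow> ('a \<Rightarrow> 'a) \<Rightarrow> bool" where
  "supercyclic B T \<longleftrightarrow> (\<exists>x\<in>vecs B. norm_dense B {scl B c ((T ^^ n) x) | c n. True})"

definition weakly_supercyclic :: "'a::ab_group_add cnspace \<Rightarrow> ('a \<Rightarrow> 'a) \<Rightarrow> bool" where
  "weakly_supercyclic B T \<longleftrightarrow> (\<exists>x\<in>vecs B. weakly_dense B {scl B c ((T ^^ n) x) | c n. True})"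

definition supercyclicity_criterion :: "'a::ab_group_add cnspace \<Rightarrow> ('a \<Rightarrow> 'a) \<Rightarrow> bool" where
  "supercyclicity_criterion B T \<longleftrightarrow>
     (\<exists>(m :: nat \<Rightarrow> nat) E F S.
        strict_mono m \<and> (\<forall>k. 0 < m k) \<and>
        norm_dense B E \<and> norm_dense B F \<and>
        S ` F \<subseteq> F \<and> (\<forall>y\<in>F. T (S y) = y) \<and>
        (\<forall>x\<in>E. \<forall>y\<in>F. (\<lambda>k. nrm B ((T ^^ m k) x) * nrm B ((S ^^ m k) y)) \<longlonglongrightarrow> 0))"

section \<open>Weighted bilateral shifts\<close>

definition ell :: "real \<Rightarrow> (int \<Rightarrow> complex) cnspace" where
  "ell p =
     \<lparr>vecs = {x. (\<lambda>n. cmod (x n) powr p) summable_on UNIV},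
      scl = (\<lambda>c x n. c * x n),
      nrm = (\<lambda>x. (\<Sum>\<^sub>\<infinity>n. cmod (x n) powr p) powr (1 / p))\<rparr>"

definition unit_seq :: "int \<Rightarrow> int \<Rightarrow> complex" where
  "unit_seq n = (\<lambda>k. if k = n then 1 else 0)"

definition weighted_bilateral_shift ::
  "real \<Rightarrow> (int \<Rightarrow> complex) \<Rightarrow> ((int \<Rightarrow> complex) \<Rightarrow> (int \<Rightarrow> complex)) \<Rightarrow> bool" where
  "weighted_bilateral_shift p w T \<longleftrightarrow>
     bounded (range w) \<and> (\<forall>n. w n \<noteq> 0) \<and>
     bounded_clinear (ell p) (ell p) T \<and>
     (\<forall>n. T (unit_seq n) = scl (ell p) (w n) (unit_seq (n - 1)))"

section \<open>The definitions are meaningful: norm axioms and existence of the shifts\<close>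

lemma (in complex_normed_space) Metric_space_nrm:
  "Metric_space (vecs B) (\<lambda>x y. nrm B (x - y))"
proof -
  interpret vector_space "scl B" by (rule vector_space)
  have diff: "x - y \<in> vecs B" if "x \<in> vecs B" "y \<in> vecs B" for x y
    using subspace_diff[OF subspace that] .
  show ?thesis
  proof
    fix x y z
    show "0 \<le> nrm B (x - y)" by (rule nrm_nonneg)
    show "nrm B (x - y) = nrm B (y - x)" by (metis nrm_minus minus_diff_eq)
    show "nrm B (x - y) = 0 \<longleftrightarrow> x = y" if "x \<in> vecs B" "y \<in> vecs B"
      using nrm_eq_0[OF diff[OF that]] by simp
    show "nrm B (x - z) \<le> nrm B (x - y) + nrm B (y - z)"
      if "x \<in> vecs B" "y \<in> vecs B" "z \<in> vecs B"
      using nrm_triangle[OF diff[OF that(1,2)] diff[OF that(2,3)]] by simp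
  qed
qed

lemma powr_convex_combination:
  fixes p a b s t :: real
  assumes "p \<ge> 1" "a > 0" "b > 0" "s \<ge> 0" "t \<ge> 0"
  shows "(s + t) powr p \<le> (a + b) powr p *
           (a / (a + b) * (s powr p / a powr p) + b / (a + b) * (t powr p / b powr p))"
proof -
  define u where "u = a / (a + b)"
  define v where "v = b / (a + b)"
  have uv: "u > 0" "v > 0" "u + v = 1" 
    using assms by (simp_all add: u_def v_def add_divide_distrib[symmetric])
  have small: "(c * r) powr p \<le> c * r powr p" if "c > 0" "c \<le> 1" "r \<ge> 0" for c r :: real
  proof -
    have "c powr p \<le> c powr 1" by (rule powr_mono') (use that assms in auto)
    then show ?thesis using that by (simp add: powr_mult mult_right_mono)
  qed
  have key: "(u * x + v * y) powr p \<le> u * x powr p + v * y powr p" if xy: "x \<ge> 0" "y \<ge> 0" for x y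
  proof (cases "x = 0 \<or> y = 0")
    case True
    then show ?thesis using small[of u x] small[of v y] uv xy by auto
  next
    case False
    have "convex_on {0<..} (\<lambda>x. x powr p)" using powr_convex assms by blast
    from convex_onD[OF this, of v x y]
    have "((1 - v) * x + v * y) powr p \<le> (1 - v) * x powr p + v * y powr p"
      using False xy uv by auto
    moreover have "1 - v = u" using uv by simp
    ultimately show ?thesis by simp
  qed
  have "u * (s / a) = s / (a + b)" "v * (t / b) = t / (a + b)"
    using assms by (simp_all add: u_def v_def)
  then have "s + t = (a + b) * (u * (s / a) + v * (t / b))"
    using assms by (simp add: add_divide_distrib[symmetric])
  then have "(s + t) powr p = (a + b) powr p * (u * (s / a) + v * (t / b)) powr p"
    using assms uv by (simp add: powr_mult)
  also have "\<dots> \<le> (a + b) powr p * (u * (s / a) powr p + v * (t / b) powr p)"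
    using key[of "s / a" "t / b"] assms by (intro mult_left_mono) auto
  finally show ?thesis using assms by (simp add: u_def v_def powr_divide)
qed

lemma complex_normed_space_ell:
  assumes p: "1 \<le> p"
  shows "complex_normed_space (ell p)"
proof -
  let ?V = "vecs (ell p)" and ?N = "nrm (ell p)"
  define P where "P x = (\<Sum>\<^sub>\<infinity>n. cmod (x n) powr p)" for x :: "int \<Rightarrow> complex"
  have V: "x \<in> ?V \<longleftrightarrow> (\<lambda>n. cmod (x n) powr p) summable_on UNIV" for x
    by (simp add: ell_def)
  have N: "?N x = P x powr (1 / p)" for x by (simp add: ell_def P_def)
  have P0: "P x \<ge> 0" for x by (simp add: P_def infsum_nonneg)
  have NP: "?N x powr p = P x" for x using P0[of x] p by (simp add: N powr_powr)
  have scl: "scl (ell p) c x = (\<lambda>n. c * x n)" for c x by (simp add: ell_def)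
  interpret vector_space "scl (ell p)"
    by unfold_locales (auto simp: scl fun_eq_iff algebra_simps)
  have N0: "?N x = 0 \<longleftrightarrow> x = 0" if "x \<in> ?V" for x
  proof
    assume "?N x = 0"
    then have "P x \<le> 0" by (simp add: N)
    then have "cmod (x n) powr p = 0" for n
      unfolding P_def by (rule nonneg_infsum_le_0D) (use that in \<open>auto simp: V\<close>)
    then show "x = 0" by (auto simp: fun_eq_iff)
  qed (simp add: N P_def)
  have sc: "scl (ell p) c x \<in> ?V \<and> ?N (scl (ell p) c x) = cmod c * ?N x" if "x \<in> ?V" for c x
  proof
    show "scl (ell p) c x \<in> ?V"
      using that by (auto simp: V scl norm_mult powr_mult intro!: summable_on_cmult_right)
    have "P (scl (ell p) c x) = cmod c powr p * P x"
      by (simp add: P_def scl norm_mult powr_mult infsum_cmult_right')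
    then show "?N (scl (ell p) c x) = cmod c * ?N x"
      using P0[of x] p by (simp add: N powr_mult powr_powr)
  qed
  have tri: "x + y \<in> ?V \<and> ?N (x + y) \<le> ?N x + ?N y" if xy: "x \<in> ?V" "y \<in> ?V" for x y
  proof (cases "x = 0 \<or> y = 0")
    case True
    then show ?thesis using xy by (auto simp: N)
  next
    case False
    define a b where "a = ?N x" and "b = ?N y"
    have ab: "a > 0" "b > 0" using False N0 xy P0
      by (auto simp: a_def b_def N order.order_iff_strict)
    define g where "g n = (a + b) powr p *
      (a / (a + b) * (cmod (x n) powr p / a powr p) + b / (a + b) * (cmod (y n) powr p / b powr p))"
      for n
    have "((\<lambda>n. cmod (x n) powr p) has_sum a powr p) UNIV"
      "((\<lambda>n. cmod (y n) powr p) has_sum b powr p) UNIV"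
      using xy by (auto simp: a_def b_def NP P_def V)
    then have "(g has_sum ((a + b) powr p *
        (a / (a + b) * (a powr p / a powr p) + b / (a + b) * (b powr p / b powr p)))) UNIV"
      unfolding g_def divide_inverse
      by (intro has_sum_cmult_right has_sum_cmult_left has_sum_add)
    moreover have "a / (a + b) * (a powr p / a powr p) + b / (a + b) * (b powr p / b powr p) = 1"
      using ab by (simp add: add_divide_distrib[symmetric])
    ultimately have g: "(g has_sum ((a + b) powr p)) UNIV" by simp
    have le: "cmod ((x + y) n) powr p \<le> g n" for n
    proof -
      have "cmod ((x + y) n) powr p \<le> (cmod (x n) + cmod (y n)) powr p"
        using p by (intro powr_mono2) (auto simp: norm_triangle_ineq)
      also have "\<dots> \<le> g n"
        unfolding g_def by (rule powr_convex_combination) (use p ab in auto)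
      finally show ?thesis .
    qed
    have s: "(\<lambda>n. cmod ((x + y) n) powr p) summable_on UNIV"
      by (rule summable_on_comparison_test[of g]) (use g le in \<open>auto simp: summable_on_def\<close>)
    have "P (x + y) \<le> (a + b) powr p"
      unfolding P_def using s g le
      by (metis (no_types, lifting) has_sum_infsum has_sum_mono)
    then have "P (x + y) powr (1 / p) \<le> ((a + b) powr p) powr (1 / p)"
      using p P0 by (intro powr_mono2) auto
    also have "\<dots> = a + b" using ab p by (simp add: powr_powr)
    finally show ?thesis using s by (simp add: V N a_def b_def)
  qed
  show ?thesis
  proof
    show "subspace ?V"
      unfolding subspace_def using tri sc by (auto simp: V)
  qed (use N0 sc tri in \<open>auto simp: N P_def\<close>)
qed

lemma complex_normed_space_direct_sum:
  assumes "complex_normed_space B" "complex_normed_space C"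
  shows "complex_normed_space (direct_sum B C)"
proof -
  interpret B: complex_normed_space B by fact
  interpret C: complex_normed_space C by fact
  interpret b: vector_space "scl B" by (rule B.vector_space)
  interpret c: vector_space "scl C" by (rule C.vector_space)
  interpret d: vector_space "scl (direct_sum B C)"
    by unfold_locales (auto simp: direct_sum_def algebra_simps b.scale_right_distrib
        c.scale_right_distrib b.scale_left_distrib c.scale_left_distrib)
  show ?thesis
  proof
    show "d.subspace (vecs (direct_sum B C))"
      using B.subspace C.subspace
      unfolding d.subspace_def b.subspace_def c.subspace_def
      by (auto simp: direct_sum_def zero_prod_def)
    fix v w c
    show "0 \<le> nrm (direct_sum B C) v"
      by (auto simp: direct_sum_def B.nrm_nonneg C.nrm_nonneg split: prod.split)
    show "nrm (direct_sum B C) (- v) = nrm (direct_sum B C) v"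
      by (cases v) (auto simp: direct_sum_def B.nrm_minus C.nrm_minus)
    assume v: "v \<in> vecs (direct_sum B C)"
    show "nrm (direct_sum B C) v = 0 \<longleftrightarrow> v = 0"
      using v by (auto simp: direct_sum_def zero_prod_def B.nrm_nonneg C.nrm_nonneg
          add_nonneg_eq_0_iff B.nrm_eq_0 C.nrm_eq_0)
    show "nrm (direct_sum B C) (scl (direct_sum B C) c v) = cmod c * nrm (direct_sum B C) v"
      using v by (auto simp: direct_sum_def B.nrm_scl C.nrm_scl algebra_simps)
    assume w: "w \<in> vecs (direct_sum B C)"
    obtain v1 v2 w1 w2 where vw: "v = (v1, v2)" "w = (w1, w2)" by (metis surj_pair)
    then show "nrm (direct_sum B C) (v + w) \<le> nrm (direct_sum B C) v + nrm (direct_sum B C) w"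
      using v w B.nrm_triangle[of v1 w1] C.nrm_triangle[of v2 w2]
      by (auto simp: direct_sum_def)
  qed
qed

lemma weighted_bilateral_shift_exists:
  assumes p: "1 \<le> p" and w: "bounded (range w)" "\<forall>n. w n \<noteq> 0"
  shows "weighted_bilateral_shift p w (\<lambda>x n. w (n + 1) * x (n + 1))"
proof -
  let ?T = "\<lambda>x n. w (n + 1) * x (n + 1)"
  obtain K where K: "cmod (w n) \<le> K" for n using w by (auto simp: bounded_iff)
  then have K0: "K \<ge> 0" using norm_ge_zero order_trans by blast
  have bij: "bij_betw (\<lambda>n::int. n + 1) UNIV UNIV"
    by (rule bij_betwI[where g = "\<lambda>n. n - 1"]) auto
  have bd: "?T x \<in> vecs (ell p) \<and> nrm (ell p) (?T x) \<le> K * nrm (ell p) x"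
    if x: "x \<in> vecs (ell p)" for x
  proof -
    let ?f = "\<lambda>n. cmod (x n) powr p"
    have f: "?f summable_on UNIV" using x by (simp add: ell_def)
    have sh: "(\<lambda>n. ?f (n + 1)) summable_on UNIV"
      using summable_on_reindex_bij_betw[OF bij, of ?f] f by simp
    have le: "cmod (?T x n) powr p \<le> K powr p * ?f (n + 1)" for n
      using p K[of "n + 1"] by (auto simp: norm_mult powr_mult intro!: mult_right_mono powr_mono2)
    have g: "(\<lambda>n. K powr p * ?f (n + 1)) summable_on UNIV"
      using sh by (rule summable_on_cmult_right)
    have s: "(\<lambda>n. cmod (?T x n) powr p) summable_on UNIV"
      by (rule summable_on_comparison_test[OF g]) (use le in auto)
    have "(\<Sum>\<^sub>\<infinity>n. cmod (?T x n) powr p) \<le> (\<Sum>\<^sub>\<infinity>n. K powr p * ?f (n + 1))"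
      by (rule infsum_mono[OF s g]) (use le in auto)
    also have "\<dots> = K powr p * (\<Sum>\<^sub>\<infinity>n. ?f n)"
      using infsum_reindex_bij_betw[OF bij, of ?f] by (simp add: infsum_cmult_right')
    finally have "(\<Sum>\<^sub>\<infinity>n. cmod (?T x n) powr p) powr (1 / p)
        \<le> (K powr p * (\<Sum>\<^sub>\<infinity>n. ?f n)) powr (1 / p)"
      using p by (intro powr_mono2) (auto intro!: infsum_nonneg)
    also have "\<dots> = K * (\<Sum>\<^sub>\<infinity>n. ?f n) powr (1 / p)"
      using p K0 by (simp add: powr_mult powr_powr infsum_nonneg)
    finally show ?thesis using s by (simp add: ell_def)
  qed
  have "bounded_clinear (ell p) (ell p) ?T"
    unfolding bounded_clinear_def using bd
    by (auto simp: ell_def fun_eq_iff algebra_simps)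
  then show ?thesis
    using w unfolding weighted_bilateral_shift_def
    by (auto simp: unit_seq_def ell_def fun_eq_iff)
qed

end

theory Submission
  imports Defs
begin

text \<open>
  Choose nonzero numbers \<open>b j\<close> with \<open>b (j - 1) = w j * b j\<close>. Then \<open>T\<close> maps \<open>b j\<close> times the
  \<open>j\<close>-th basis vector to \<open>b (j - 1)\<close> times the \<open>(j - 1)\<close>-st one, so it is the unweighted backward
  shift of a space whose \<open>j\<close>-th basis vector has norm \<open>\<bar>b j\<bar>\<close>. All six statements turn out to be
  equivalent to one condition on \<open>b\<close>, called \<open>small_products\<close>: around every centre \<open>q\<close> the products
  \<open>\<bar>b (q - n) * b (q + n)\<bar>\<close> come arbitrarily close to 0.

  Suppose that the products are small. On finitely supported vectors the norms of the iterates of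
  \<open>T ^^ N\<close> and of its right inverse, the forward shift, are controlled by \<open>\<bar>b (i - N * n)\<bar>\<close> and
  \<open>\<bar>b (j + N * n)\<bar>\<close>. Boundedness of the weights lets \<open>i\<close>, \<open>j\<close> and the step \<open>N\<close> be absorbed into a
  change of the centre, so that \<open>T ^^ N\<close> satisfies the Supercyclicity Criterion for every \<open>N \<ge> 1\<close>
  (\<open>supercyclicity_criterion_power\<close>). The criterion is inherited by \<open>T \<oplus> T\<close>, and in a complete
  separable space the Baire category theorem turns it into a supercyclic vector
  (\<open>supercyclicity_criterion_imp_supercyclic\<close>). Supercyclic operators are cyclic and weakly
  supercyclic, and all six statements follow.

  Suppose that the products are not small. Then \<open>\<bar>b j * b (s - j)\<bar>\<close> is bounded away from 0 for
  suitable \<open>s\<close> (both \<open>s = 2 * q\<close> and \<open>s = 2 * q + 1\<close> for some \<open>q\<close>). As \<open>p \<le> 2\<close>, the sequences lie in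
  \<open>\<ell>\<^sub>2\<close>, and the symmetric bilinear form
  \<open>\<langle>z, y\<rangle> = (\<Sum>j. z j * y (s - j) / (b j * b (s - j)))\<close> is defined and continuous. The shift is
  self-adjoint for it: \<open>\<langle>T z, y\<rangle> = \<langle>z, T y\<rangle>\<close>. Antisymmetrising gives functionals that annihilate orbits:

  \<^item> \<open>(u, v) \<mapsto> \<langle>u, y\<rangle> - \<langle>v, x\<rangle>\<close> vanishes on the orbit of \<open>(x, y)\<close> under \<open>T \<oplus> T\<close>, which is
    therefore not cyclic.

  \<^item> Let \<open>N \<ge> 2\<close> and let \<open>z\<^sub>0\<close>, \<open>z\<^sub>1\<close> be the parts of \<open>z\<close> supported on the residue classes of \<open>q\<close> and
    \<open>q + 1\<close> modulo \<open>N\<close>, which the reflection \<open>j \<mapsto> 2 * q + 1 - j\<close> exchanges. Then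
    \<open>z \<mapsto> \<langle>z\<^sub>0, x\<rangle> - \<langle>z\<^sub>1, x\<rangle>\<close> vanishes on the orbit of \<open>x\<close> under \<open>T ^^ N\<close>, so no such power is cyclic.

  \<^item> The orbit of \<open>x\<close> under \<open>T\<close> consists of two orbits under \<open>T ^^ 2\<close>. Weak density of its multiples
    would make the space the union of the kernels of two nonzero functionals, which is impossible.
\<close>

section \<open>Continuous linear maps between normed spaces\<close>

sublocale complex_normed_space \<subseteq> vs: vector_space "scl B"
  by (rule vector_space)

sublocale complex_normed_space \<subseteq> ms: Metric_space "vecs B" "\<lambda>x y. nrm B (x - y)"
  rewrites "Metric_space.mtopology (vecs B) (\<lambda>x y. nrm B (x - y)) = norm_topology B"
  by (rule Metric_space_nrm) (simp add: norm_topology_def)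

context complex_normed_space
begin

lemmas zero_mem [simp, intro] = vs.subspace_0[OF subspace]
lemmas add_mem [simp, intro] = vs.subspace_add[OF subspace]
lemmas diff_mem [simp, intro] = vs.subspace_diff[OF subspace]
lemmas scl_mem [simp, intro] = vs.subspace_scale[OF subspace]

lemma nrm_0 [simp]: "nrm B 0 = 0"
  using nrm_eq_0 zero_mem by blast

lemma nrm_sum_le:
  assumes "\<And>i. i \<in> I \<Longrightarrow> f i \<in> vecs B"
  shows "nrm B (\<Sum>i\<in>I. f i) \<le> (\<Sum>i\<in>I. nrm B (f i))"
  using assms
proof (induction I rule: infinite_finite_induct)
  case (insert i I)
  then have "nrm B (f i + sum f I) \<le> nrm B (f i) + nrm B (sum f I)"
    by (intro nrm_triangle vs.subspace_sum[OF subspace]) auto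
  then show ?case using insert by force
qed auto

lemma norm_dense_iff:
  "norm_dense B S \<longleftrightarrow> S \<subseteq> vecs B \<and> (\<forall>x\<in>vecs B. \<forall>e>0. \<exists>s\<in>S. nrm B (x - s) < e)"
proof (cases "S \<subseteq> vecs B")
  case True
  have "norm_topology B closure_of S = {x \<in> vecs B. \<forall>e>0. \<exists>s\<in>S. s \<in> ms.mball x e}"
    by (rule ms.metric_closure_of)
  then show ?thesis using True unfolding norm_dense_def by (auto simp: subset_iff) blast
qed (simp add: norm_dense_def)

lemma norm_denseD:
  assumes "norm_dense B S"
  shows norm_dense_subset: "S \<subseteq> vecs B"
    and norm_dense_approx: "x \<in> vecs B \<Longrightarrow> e > 0 \<Longrightarrow> \<exists>s\<in>S. nrm B (x - s) < e"
  using assms unfolding norm_dense_iff by blast+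

lemma norm_dense_mono: "norm_dense B S \<Longrightarrow> S \<subseteq> S' \<Longrightarrow> S' \<subseteq> vecs B \<Longrightarrow> norm_dense B S'"
  unfolding norm_dense_iff by (meson subsetD)

end

lemma complex_normed_space_scalars: "complex_normed_space scalars"
proof -
  interpret vector_space "scl scalars"
    by unfold_locales (auto simp: scalars_def algebra_simps)
  show ?thesis
    by unfold_locales (auto simp: scalars_def norm_mult norm_triangle_ineq subspace_def)
qed

lemma norm_topology_scalars: "norm_topology scalars = euclidean"
proof -
  have "(\<lambda>x y. cmod (x - y)) = dist" by (auto simp: dist_norm fun_eq_iff)
  then show ?thesis by (simp add: norm_topology_def scalars_def)
qed

lemma bounded_clinearD:
  assumes "bounded_clinear B C f"
  shows bounded_clinear_mem: "x \<in> vecs B \<Longrightarrow> f x \<in> vecs C"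
    and bounded_clinear_add: "x \<in> vecs B \<Longrightarrow> y \<in> vecs B \<Longrightarrow> f (x + y) = f x + f y"
    and bounded_clinear_scl: "x \<in> vecs B \<Longrightarrow> f (scl B c x) = scl C c (f x)"
  using assms by (auto simp: bounded_clinear_def)

lemma bounded_clinear_bound:
  assumes "complex_normed_space B" "bounded_clinear B C f"
  obtains K where "K > 0" "\<And>x. x \<in> vecs B \<Longrightarrow> nrm C (f x) \<le> K * nrm B x"
proof -
  interpret complex_normed_space B by fact
  obtain K where K: "\<And>x. x \<in> vecs B \<Longrightarrow> nrm C (f x) \<le> K * nrm B x"
    using assms(2) unfolding bounded_clinear_def by blast
  have "nrm C (f x) \<le> max K 1 * nrm B x" if "x \<in> vecs B" for x
    using K[OF that] mult_right_mono[of K "max K 1" "nrm B x"] nrm_nonneg[of x] by linarith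
  then show ?thesis by (intro that[of "max K 1"]) auto
qed

lemma bounded_clinear_diff:
  assumes "complex_normed_space B" "complex_normed_space C" "bounded_clinear B C f"
    and x: "x \<in> vecs B" and y: "y \<in> vecs B"
  shows "f (x - y) = f x - f y"
proof -
  interpret B: complex_normed_space B by fact
  have "f x = f ((x - y) + y)" by simp
  also have "\<dots> = f (x - y) + f y"
    by (rule bounded_clinear_add[OF assms(3)]) (use x y in auto)
  finally show ?thesis by simp
qed

lemma bounded_clinear_id: "bounded_clinear B B (\<lambda>x. x)"
  unfolding bounded_clinear_def by (auto intro!: exI[of _ 1])

lemma bounded_clinear_compose:
  assumes "complex_normed_space B" "complex_normed_space C"
    and f: "bounded_clinear B C f" and g: "bounded_clinear C D g"
  shows "bounded_clinear B D (\<lambda>x. g (f x))"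
proof -
  obtain K where K: "K > 0" "\<And>x. x \<in> vecs B \<Longrightarrow> nrm C (f x) \<le> K * nrm B x"
    using bounded_clinear_bound assms(1) f by blast
  obtain L where L: "L > 0" "\<And>x. x \<in> vecs C \<Longrightarrow> nrm D (g x) \<le> L * nrm C x"
    using bounded_clinear_bound assms(2) g by blast
  have "nrm D (g (f x)) \<le> L * K * nrm B x" if x: "x \<in> vecs B" for x
  proof -
    have "nrm D (g (f x)) \<le> L * nrm C (f x)"
      by (rule L(2)) (use bounded_clinear_mem[OF f] x in auto)
    also have "\<dots> \<le> L * (K * nrm B x)"
      using K(2)[OF x] L(1) by (intro mult_left_mono) auto
    finally show ?thesis by (simp add: mult.assoc)
  qed
  then show ?thesis
    using f g unfolding bounded_clinear_def by (auto simp: image_subset_iff)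
qed

lemma bounded_clinear_funpow:
  assumes "complex_normed_space B" "bounded_clinear B B T"
  shows "bounded_clinear B B (T ^^ n)"
proof (induction n)
  case 0
  then show ?case using bounded_clinear_id[of B] by (simp add: id_def)
next
  case (Suc n)
  then show ?case
    using bounded_clinear_compose[OF assms(1,1) Suc assms(2)] by (simp add: o_def)
qed

lemma bounded_clinear_minus:
  assumes "complex_normed_space B" "complex_normed_space C"
    and f: "bounded_clinear B C f" and g: "bounded_clinear B C g"
  shows "bounded_clinear B C (\<lambda>x. f x - g x)"
proof -
  interpret B: complex_normed_space B by fact
  interpret C: complex_normed_space C by fact
  obtain K where K: "K > 0" "\<And>x. x \<in> vecs B \<Longrightarrow> nrm C (f x) \<le> K * nrm B x"
    using bounded_clinear_bound assms(1) f by blast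
  obtain L where L: "L > 0" "\<And>x. x \<in> vecs B \<Longrightarrow> nrm C (g x) \<le> L * nrm B x"
    using bounded_clinear_bound assms(1) g by blast
  show ?thesis
    unfolding bounded_clinear_def
  proof (intro conjI ballI allI exI[of _ "K + L"])
    show "(\<lambda>x. f x - g x) ` vecs B \<subseteq> vecs C"
      using bounded_clinear_mem[OF f] bounded_clinear_mem[OF g] by auto
    fix x assume x: "x \<in> vecs B"
    have "nrm C (f x - g x) \<le> nrm C (f x) + nrm C (g x)"
      using C.ms.triangle[of "f x" 0 "g x"] bounded_clinear_mem[OF f x] bounded_clinear_mem[OF g x]
      by (simp add: C.nrm_minus)
    then show "nrm C (f x - g x) \<le> (K + L) * nrm B x"
      using K(2)[OF x] L(2)[OF x] by (simp add: algebra_simps)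
    show "f (scl B c x) - g (scl B c x) = scl C c (f x - g x)" for c
      using bounded_clinear_scl[OF f x] bounded_clinear_scl[OF g x]
      by (simp add: C.vs.scale_right_diff_distrib)
    show "f (x + y) - g (x + y) = (f x - g x) + (f y - g y)" if "y \<in> vecs B" for y
      using bounded_clinear_add[OF f x that] bounded_clinear_add[OF g x that] by simp
  qed
qed

lemma (in complex_normed_space) bounded_clinear_scale: "bounded_clinear B B (scl B c)"
  unfolding bounded_clinear_def
  by (auto simp: vs.scale_right_distrib vs.scale_left_commute nrm_scl intro!: exI[of _ "cmod c"])

lemma continuous_map_bounded_clinear:
  assumes B: "complex_normed_space B" and C: "complex_normed_space C" and f: "bounded_clinear B C f"
  shows "continuous_map (norm_topology B) (norm_topology C) f"
proof -
  interpret B: complex_normed_space B by fact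
  interpret C: complex_normed_space C by fact
  obtain K where K: "K > 0" "\<And>x. x \<in> vecs B \<Longrightarrow> nrm C (f x) \<le> K * nrm B x"
    using bounded_clinear_bound B f by blast
  have "\<exists>\<delta>>0. \<forall>x. x \<in> vecs B \<and> nrm B (a - x) < \<delta> \<longrightarrow> nrm C (f a - f x) < e"
    if a: "a \<in> vecs B" and e: "e > 0" for a e
  proof (intro exI[of _ "e / K"] conjI allI impI)
    fix x assume x: "x \<in> vecs B \<and> nrm B (a - x) < e / K"
    have "nrm C (f a - f x) = nrm C (f (a - x))"
      using bounded_clinear_diff[OF B C f] a x by simp
    also have "\<dots> \<le> K * nrm B (a - x)" using K(2) a x by simp
    also have "\<dots> < e" using x K(1) by (simp add: field_simps)
    finally show "nrm C (f a - f x) < e" .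
  qed (use e K in auto)
  then show ?thesis
    using bounded_clinear_mem[OF f]
    unfolding norm_topology_def
    by (subst Metric_space.metric_continuous_map[OF B.Metric_space_nrm C.Metric_space_nrm]) auto
qed

text \<open>
  Applied with scalar values, this is how failure of cyclicity is detected; applied to the
  difference of two maps, it says that a continuous linear map is determined by a total set.
\<close>

lemma bounded_clinear_eq_0_if_dense_span:
  assumes B: "complex_normed_space B" and C: "complex_normed_space C" and f: "bounded_clinear B C f"
    and dense: "norm_dense B (module.span (scl B) S)"
    and S: "S \<subseteq> vecs B" "\<And>s. s \<in> S \<Longrightarrow> f s = 0"
    and x: "x \<in> vecs B"
  shows "f x = 0"
proof (rule ccontr)
  interpret B: complex_normed_space B by fact
  interpret C: complex_normed_space C by fact
  have ker: "B.vs.subspace {y \<in> vecs B. f y = 0}"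
    unfolding B.vs.subspace_def
    using bounded_clinear_add[OF f] bounded_clinear_scl[OF f]
      bounded_clinear_scl[OF f, of 0 0] by auto
  have span: "f y = 0" if "y \<in> B.vs.span S" for y
    using B.vs.span_minimal[OF _ ker, of S] S that by auto
  assume "f x \<noteq> 0"
  then have pos: "nrm C (f x) > 0"
    using bounded_clinear_mem[OF f x] C.nrm_eq_0 C.nrm_nonneg[of "f x"] by fastforce
  obtain K where K: "K > 0" "\<And>x. x \<in> vecs B \<Longrightarrow> nrm C (f x) \<le> K * nrm B x"
    using bounded_clinear_bound B f by blast
  obtain y where y: "y \<in> B.vs.span S" "nrm B (x - y) < nrm C (f x) / K"
    using dense x K(1) pos unfolding B.norm_dense_iff by (metis divide_pos_pos)
  then have yB: "y \<in> vecs B" using dense unfolding B.norm_dense_iff by auto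
  have "nrm C (f x) = nrm C (f (x - y))"
    using bounded_clinear_diff[OF B C f x yB] span[OF y(1)] by simp
  also have "\<dots> \<le> K * nrm B (x - y)" using K(2) x yB by simp
  also have "\<dots> < nrm C (f x)" using y(2) K(1) by (simp add: field_simps)
  finally show False by simp
qed

section \<open>From the Supercyclicity Criterion to supercyclic and cyclic operators\<close>

lemma funpow_mem_right_inverse:
  assumes "S ` F \<subseteq> F" "\<And>y. y \<in> F \<Longrightarrow> T (S y) = y" "y \<in> F"
  shows "(S ^^ n) y \<in> F" and "(T ^^ n) ((S ^^ n) y) = y"
proof -
  show mem: "(S ^^ n) y \<in> F" for n
    using assms(1,3) by (induction n) auto
  show "(T ^^ n) ((S ^^ n) y) = y"
  proof (induction n)
    case (Suc n)
    have "(T ^^ Suc n) ((S ^^ Suc n) y) = (T ^^ n) (T (S ((S ^^ n) y)))"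
      by (simp add: funpow_swap1)
    then show ?case using assms(2)[OF mem] Suc by simp
  qed simp
qed

text \<open>
  A small product of two norms can be split evenly: scaling one vector by \<open>c\<close> and the other by \<open>1 / c\<close>
  makes both short.
\<close>

lemma exists_balancing_factor:
  fixes a b d :: real
  assumes "a * b < d\<^sup>2" "a \<ge> 0" "b \<ge> 0" "d > 0"
  obtains c where "c > 0" "c * a < d" "b / c < d"
proof (cases "a = 0")
  case True
  show ?thesis
    by (rule that[of "b / d + 1"]) (use True assms in \<open>auto simp: field_simps add_pos_nonneg add_nonneg_pos\<close>)
next
  case False
  then have "b / d < d / a" using assms by (simp add: field_simps power2_eq_square)
  then obtain c where c: "b / d < c" "c < d / a" using dense by blast
  then have "c > 0" using assms by (meson divide_nonneg_pos le_less_trans)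
  then show ?thesis using that[of c] c False assms by (simp add: field_simps)
qed

text \<open>
  The vectors whose scaled orbit enters a given ball form an open set, and by the Baire category
  theorem a dense intersection of countably many such sets remains if each of them is dense. For
  density, start near \<open>x\<close> in \<open>E\<close> and aim at \<open>y\<close> in \<open>F\<close>: a small multiple of \<open>(S ^^ n) y\<close> added to \<open>x\<close>
  is sent by \<open>T ^^ n\<close> close to the same multiple of \<open>y\<close>, because the criterion allows the multiple to
  be balanced against the size of \<open>(T ^^ n) x\<close>.
\<close>

lemma supercyclicity_criterion_imp_supercyclic:
  assumes B: "complex_normed_space B" and complete: "Metric_space.mcomplete (vecs B) (\<lambda>x y. nrm B (x - y))"
    and D: "countable D" "norm_dense B D" and T: "bounded_clinear B B T"
    and crit: "supercyclicity_criterion B T"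
  shows "supercyclic B T"
proof -
  interpret complex_normed_space B by (rule B)
  obtain m E F S where EF: "norm_dense B E" "norm_dense B F" and S: "S ` F \<subseteq> F" "\<forall>y\<in>F. T (S y) = y"
    and lim: "\<forall>x\<in>E. \<forall>y\<in>F. (\<lambda>k. nrm B ((T ^^ m k) x) * nrm B ((S ^^ m k) y)) \<longlonglongrightarrow> 0"
    using crit unfolding supercyclicity_criterion_def by blast
  have sub: "E \<subseteq> vecs B" "F \<subseteq> vecs B" "D \<subseteq> vecs B" using EF D by (auto simp: norm_dense_iff)
  define f where "f c n x = scl B c ((T ^^ n) x)" for c n x
  have Tn: "bounded_clinear B B (T ^^ n)" for n using bounded_clinear_funpow[OF B T] .
  have f: "bounded_clinear B B (f c n)" for c n
    using bounded_clinear_compose[OF B B Tn bounded_clinear_scale] by (simp add: f_def[abs_def])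
  define G where "G y r = (\<Union>c. \<Union>n. {x \<in> vecs B. f c n x \<in> ms.mball y r})" for y r
  have G_open: "openin (norm_topology B) (G y r)" for y r
  proof -
    have "openin (norm_topology B) {x \<in> vecs B. f c n x \<in> ms.mball y r}" for c n
      using openin_continuous_map_preimage[OF continuous_map_bounded_clinear[OF B B f] ms.openin_mball]
      by simp
    then show ?thesis unfolding G_def by (auto intro!: openin_Union)
  qed
  have G_dense: "norm_dense B (G y r)" if y: "y \<in> vecs B" and r: "r > 0" for y r
    unfolding norm_dense_iff
  proof (intro conjI ballI allI impI)
    show "G y r \<subseteq> vecs B" by (auto simp: G_def)
    fix u e assume u: "u \<in> vecs B" and e: "(e::real) > 0"
    obtain x where x: "x \<in> E" "nrm B (u - x) < e / 2"
      using norm_dense_approx[OF EF(1) u half_gt_zero[OF e]] by blast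
    obtain y' where y': "y' \<in> F" "nrm B (y - y') < r / 2"
      using norm_dense_approx[OF EF(2) y half_gt_zero[OF r]] by blast
    \<comment> \<open>Both errors split into halves: one from the density of E and F, one from the balancing.\<close>
    define d where "d = min e r / 2"
    have d: "d > 0" "d \<le> e / 2" "d \<le> r / 2" using e r by (auto simp: d_def)
    obtain k where k: "nrm B ((T ^^ m k) x) * nrm B ((S ^^ m k) y') < d\<^sup>2"
      using order_tendstoD(2)[OF lim[rule_format, OF x(1) y'(1)], of "d\<^sup>2"] d
      by (auto simp: eventually_sequentially)
    define n where "n = m k"
    define s where "s = (S ^^ n) y'"
    have s: "s \<in> vecs B" "(T ^^ n) s = y'"
      using funpow_mem_right_inverse[of S F T y' n] S y' sub by (auto simp: s_def)
    have xB: "x \<in> vecs B" and y'B: "y' \<in> vecs B" using x y' sub by auto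
    obtain c where c: "c > 0" "c * nrm B ((T ^^ n) x) < d" "nrm B s / c < d"
      by (rule exists_balancing_factor[of "nrm B ((T ^^ n) x)" "nrm B s" d])
        (use k d nrm_nonneg in \<open>auto simp: n_def s_def\<close>)
    define z where "z = x + scl B (of_real (1 / c)) s"
    have zB: "z \<in> vecs B" using xB s by (auto simp: z_def)
    have Tx: "(T ^^ n) x \<in> vecs B" using bounded_clinear_mem[OF Tn xB] .
    have "(T ^^ n) z = (T ^^ n) x + scl B (of_real (1 / c)) y'"
      using bounded_clinear_add[OF Tn xB] bounded_clinear_scl[OF Tn] s by (simp add: z_def)
    then have fz: "f (of_real c) n z = scl B (of_real c) ((T ^^ n) x) + y'"
      using c by (simp add: f_def vs.scale_right_distrib flip: of_real_mult)
    have "nrm B (y - f (of_real c) n z) = nrm B ((y - y') - scl B (of_real c) ((T ^^ n) x))"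
      by (simp add: fz algebra_simps)
    also have "\<dots> \<le> nrm B (y - y') + nrm B (scl B (of_real c) ((T ^^ n) x))"
      using nrm_triangle[of "y - y'" "- scl B (of_real c) ((T ^^ n) x)"] y y'B Tx
        vs.subspace_neg[OF subspace]
      by (simp add: nrm_minus)
    also have "\<dots> < r" using c d y'(2) Tx by (simp add: nrm_scl)
    finally have "z \<in> G y r" using zB y bounded_clinear_mem[OF f zB] by (auto simp: G_def)
    moreover have "nrm B (u - z) < e"
    proof -
      have "nrm B (u - z) = nrm B ((u - x) - scl B (of_real (1 / c)) s)"
        by (simp add: z_def algebra_simps)
      also have "\<dots> \<le> nrm B (u - x) + nrm B (scl B (of_real (1 / c)) s)"
        using nrm_triangle[of "u - x" "- scl B (of_real (1 / c)) s"] u xB s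
          vs.subspace_neg[OF subspace]
        by (simp add: nrm_minus)
      also have "\<dots> < e" using c d x(2) s by (simp add: nrm_scl norm_divide)
      finally show ?thesis .
    qed
    ultimately show "\<exists>s\<in>G y r. nrm B (u - s) < e" by blast
  qed
  define \<G> where "\<G> = (\<lambda>(y, i). G y (1 / real (Suc i))) ` (D \<times> UNIV)"
  have "norm_topology B closure_of \<Inter>\<G> = vecs B"
  proof (rule ms.metric_Baire_category)
    show "countable \<G>" using D(1) by (auto simp: \<G>_def)
    fix V assume "V \<in> \<G>"
    then obtain y i where "V = G y (1 / real (Suc i))" "y \<in> D" by (auto simp: \<G>_def)
    then show "openin (norm_topology B) V \<and> norm_topology B closure_of V = vecs B"
      using G_open G_dense[of y "1 / real (Suc i)"] sub by (auto simp: norm_dense_def)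
  qed (rule complete)
  then obtain x where x: "x \<in> \<Inter>\<G>"
    using zero_mem closure_of_empty[of "norm_topology B"] by (metis all_not_in_conv)
  have xG: "x \<in> G y (1 / real (Suc i))" if "y \<in> D" for y i
    using x that unfolding \<G>_def by blast
  obtain y0 where "y0 \<in> D" using norm_dense_approx[OF D(2) zero_mem zero_less_one] by blast
  then have xB: "x \<in> vecs B" using xG by (auto simp: G_def)
  have "norm_dense B {f c n x | c n. True}"
    unfolding norm_dense_iff
  proof (intro conjI ballI allI impI)
    show "{f c n x |c n. True} \<subseteq> vecs B" using bounded_clinear_mem[OF f xB] by auto
    fix v e assume v: "v \<in> vecs B" and e: "(e::real) > 0"
    obtain y where y: "y \<in> D" "nrm B (v - y) < e / 2"
      using norm_dense_approx[OF D(2) v half_gt_zero[OF e]] by blast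
    obtain i where i: "1 / real (Suc i) < e / 2"
      using e by (metis half_gt_zero nat_approx_posE)
    obtain c n where "f c n x \<in> ms.mball y (1 / real (Suc i))"
      using xG[OF y(1), of i] by (auto simp: G_def)
    then have "nrm B (y - f c n x) < e / 2" using i by auto
    moreover have "nrm B (v - f c n x) \<le> nrm B (v - y) + nrm B (y - f c n x)"
      using ms.triangle[of v y "f c n x"] v y sub bounded_clinear_mem[OF f xB] by auto
    ultimately have "nrm B (v - f c n x) < e" using y(2) by linarith
    then show "\<exists>s\<in>{f c n x |c n. True}. nrm B (v - s) < e" by blast
  qed
  then show ?thesis using xB unfolding supercyclic_def f_def by blast
qed

lemma supercyclic_imp_cyclic:
  assumes B: "complex_normed_space B" and T: "bounded_clinear B B T" and "supercyclic B T"
  shows "cyclic B T"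
proof -
  interpret complex_normed_space B by (rule B)
  obtain x where x: "x \<in> vecs B" "norm_dense B {scl B c ((T ^^ n) x) | c n. True}"
    using assms(3) by (auto simp: supercyclic_def)
  have "(T ^^ n) x \<in> vecs B" for n
    using bounded_clinear_mem[OF bounded_clinear_funpow[OF B T] x(1)] .
  then have "vs.span {(T ^^ n) x | n. True} \<subseteq> vecs B"
    by (intro vs.span_minimal[OF _ subspace]) auto
  moreover have "{scl B c ((T ^^ n) x) | c n. True} \<subseteq> vs.span {(T ^^ n) x | n. True}"
  proof clarify
    fix c n
    have "(T ^^ n) x \<in> {(T ^^ n) x | n. True}" by blast
    then show "scl B c ((T ^^ n) x) \<in> vs.span {(T ^^ n) x | n. True}"
      by (intro vs.span_scale vs.span_base)
  qed
  ultimately show ?thesis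
    using norm_dense_mono[OF x(2)] x(1) unfolding cyclic_def by blast
qed

section \<open>The weak topology\<close>

context complex_normed_space
begin

lemma openin_weak_preimage:
  assumes "bounded_clinear B scalars f" "open U"
  shows "openin (weak_topology B) {x \<in> vecs B. f x \<in> U}"
  unfolding weak_topology_def using assms by (intro topology_generated_by_Basis) blast

lemma topspace_weak_topology: "topspace (weak_topology B) = vecs B"
proof -
  have "bounded_clinear B scalars (\<lambda>_. 0)"
    by (auto simp: bounded_clinear_def scalars_def nrm_nonneg intro!: exI[of _ 1])
  then have "openin (weak_topology B) (vecs B)"
    using openin_weak_preimage[of "\<lambda>_. 0" UNIV] by simp
  moreover have "topspace (weak_topology B) \<subseteq> vecs B"
    by (auto simp: weak_topology_def)
  ultimately show ?thesis using openin_subset by blast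
qed

lemma openin_weak_imp_norm:
  assumes "openin (weak_topology B) U"
  shows "openin (norm_topology B) U"
proof -
  have "generate_topology_on {{x \<in> vecs B. f x \<in> U} | f U. bounded_clinear B scalars f \<and> open U} U"
    using assms by (simp add: weak_topology_def openin_topology_generated_by_iff)
  moreover have "openin (norm_topology B) V"
    if "V \<in> {{x \<in> vecs B. f x \<in> U} | f U. bounded_clinear B scalars f \<and> open U}" for V
    using that openin_continuous_map_preimage[OF continuous_map_bounded_clinear[OF
          complex_normed_space_axioms complex_normed_space_scalars]]
    by (auto simp: norm_topology_scalars)
  ultimately show ?thesis
    using generate_topology_on_coarsest[OF istopology_openin] by (metis (no_types, lifting))
qed

lemma norm_dense_imp_weakly_dense:
  assumes "norm_dense B S"
  shows "weakly_dense B S"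
  using assms openin_weak_imp_norm
  unfolding norm_dense_def weakly_dense_def
  by (auto simp: closure_of_def topspace_weak_topology set_eq_iff) meson

lemma supercyclic_imp_weakly_supercyclic: "supercyclic B T \<Longrightarrow> weakly_supercyclic B T"
  unfolding supercyclic_def weakly_supercyclic_def using norm_dense_imp_weakly_dense by blast

text \<open>
  If both functionals were nonzero, there would be a point where neither vanishes, and the points
  with this property form a weakly open set that misses the dense one.
\<close>

lemma weakly_dense_Un_annihilated:
  assumes f: "bounded_clinear B scalars f" "\<And>s. s \<in> S \<Longrightarrow> f s = 0"
    and g: "bounded_clinear B scalars g" "\<And>s. s \<in> S' \<Longrightarrow> g s = 0"
    and dense: "weakly_dense B (S \<union> S')"
  shows "(\<forall>x\<in>vecs B. f x = 0) \<or> (\<forall>x\<in>vecs B. g x = 0)"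
proof (rule ccontr)
  assume "\<not> ?thesis"
  then obtain u v where uv: "u \<in> vecs B" "v \<in> vecs B" "f u \<noteq> 0" "g v \<noteq> 0" by blast
  have "f (u + v) = f u + f v" "g (u + v) = g u + g v"
    using f g uv by (auto intro: bounded_clinear_add)
  then obtain z where z: "z \<in> vecs B" "f z \<noteq> 0" "g z \<noteq> 0"
    using uv add_mem by (metis add.left_neutral add.right_neutral)
  define U where "U = {x \<in> vecs B. f x \<in> -{0}} \<inter> {x \<in> vecs B. g x \<in> -{0}}"
  have "openin (weak_topology B) U"
    unfolding U_def using f(1) g(1) by (intro openin_Int openin_weak_preimage) auto
  moreover have "z \<in> U" "z \<in> weak_topology B closure_of (S \<union> S')"
    using z dense by (auto simp: U_def weakly_dense_def)
  ultimately obtain s where "s \<in> S \<union> S'" "s \<in> U" unfolding in_closure_of by blast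
  then show False using f(2) g(2) by (auto simp: U_def)
qed

end

section \<open>Direct sums\<close>

lemma funpow_map_prod:
  fixes f :: "'a \<Rightarrow> 'a" and g :: "'b \<Rightarrow> 'b"
  shows "(map_prod f g ^^ n) = map_prod (f ^^ n) (g ^^ n)"
  by (induction n) (auto simp: fun_eq_iff)

lemma norm_dense_direct_sum:
  assumes "complex_normed_space B" "complex_normed_space C" "norm_dense B D" "norm_dense C E"
  shows "norm_dense (direct_sum B C) (D \<times> E)"
proof -
  interpret B: complex_normed_space B by fact
  interpret C: complex_normed_space C by fact
  interpret P: complex_normed_space "direct_sum B C"
    by (rule complex_normed_space_direct_sum[OF assms(1,2)])
  have "\<exists>s\<in>D \<times> E. nrm B (x - fst s) + nrm C (y - snd s) < e"
    if xy: "x \<in> vecs B" "y \<in> vecs C" and e: "e > 0" for x y e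
  proof -
    obtain d where "d \<in> D" "nrm B (x - d) < e / 2"
      using B.norm_dense_approx[OF assms(3) xy(1) half_gt_zero[OF e]] by blast
    moreover obtain d' where "d' \<in> E" "nrm C (y - d') < e / 2"
      using C.norm_dense_approx[OF assms(4) xy(2) half_gt_zero[OF e]] by blast
    ultimately show ?thesis by (intro bexI[of _ "(d, d')"]) auto
  qed
  then show ?thesis
    using B.norm_dense_subset[OF assms(3)] C.norm_dense_subset[OF assms(4)]
    unfolding P.norm_dense_iff by (auto simp: direct_sum_def case_prod_unfold)
qed

lemma mcomplete_direct_sum:
  assumes "complex_normed_space B" "complex_normed_space C"
    and cB: "Metric_space.mcomplete (vecs B) (\<lambda>x y. nrm B (x - y))"
    and cC: "Metric_space.mcomplete (vecs C) (\<lambda>x y. nrm C (x - y))"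
  shows "Metric_space.mcomplete (vecs (direct_sum B C)) (\<lambda>x y. nrm (direct_sum B C) (x - y))"
proof -
  interpret B: complex_normed_space B by fact
  interpret C: complex_normed_space C by fact
  interpret P: complex_normed_space "direct_sum B C"
    by (rule complex_normed_space_direct_sum[OF assms(1,2)])
  have vecs: "vecs (direct_sum B C) = vecs B \<times> vecs C" by (simp add: direct_sum_def)
  have nrm: "nrm (direct_sum B C) z = nrm B (fst z) + nrm C (snd z)" for z
    by (simp add: direct_sum_def case_prod_unfold)
  show ?thesis
    unfolding P.ms.mcomplete_def
  proof (intro allI impI)
    fix \<sigma> assume \<sigma>: "P.ms.MCauchy \<sigma>"
    have mem: "fst (\<sigma> n) \<in> vecs B" "snd (\<sigma> n) \<in> vecs C" for n
      using \<sigma>[unfolded P.ms.MCauchy_def] unfolding vecs by (auto simp: image_subset_iff mem_Times_iff)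
    have "B.ms.MCauchy (fst \<circ> \<sigma>)"
      unfolding B.ms.MCauchy_def
    proof (intro conjI allI impI)
      fix e :: real assume "e > 0"
      then obtain N where "\<forall>n n'. N \<le> n \<longrightarrow> N \<le> n' \<longrightarrow> nrm (direct_sum B C) (\<sigma> n - \<sigma> n') < e"
        using \<sigma> unfolding P.ms.MCauchy_def by blast
      then show "\<exists>N. \<forall>n n'. N \<le> n \<longrightarrow> N \<le> n' \<longrightarrow> nrm B ((fst \<circ> \<sigma>) n - (fst \<circ> \<sigma>) n') < e"
        using C.nrm_nonneg by (intro exI[of _ N]) (simp add: nrm, smt (verit))
    qed (use mem in auto)
    then obtain x where x: "limitin (norm_topology B) (fst \<circ> \<sigma>) x sequentially"
      using cB unfolding B.ms.mcomplete_def by blast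
    have "C.ms.MCauchy (snd \<circ> \<sigma>)"
      unfolding C.ms.MCauchy_def
    proof (intro conjI allI impI)
      fix e :: real assume "e > 0"
      then obtain N where "\<forall>n n'. N \<le> n \<longrightarrow> N \<le> n' \<longrightarrow> nrm (direct_sum B C) (\<sigma> n - \<sigma> n') < e"
        using \<sigma> unfolding P.ms.MCauchy_def by blast
      then show "\<exists>N. \<forall>n n'. N \<le> n \<longrightarrow> N \<le> n' \<longrightarrow> nrm C ((snd \<circ> \<sigma>) n - (snd \<circ> \<sigma>) n') < e"
        using B.nrm_nonneg by (intro exI[of _ N]) (simp add: nrm, smt (verit))
    qed (use mem in auto)
    then obtain y where y: "limitin (norm_topology C) (snd \<circ> \<sigma>) y sequentially"
      using cC unfolding C.ms.mcomplete_def by blast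
    have "\<forall>\<^sub>F n in sequentially. \<sigma> n \<in> vecs B \<times> vecs C \<and> nrm (direct_sum B C) (\<sigma> n - (x, y)) < e"
      if e: "e > 0" for e
    proof -
      have "\<forall>\<^sub>F n in sequentially. nrm B (fst (\<sigma> n) - x) < e / 2"
        "\<forall>\<^sub>F n in sequentially. nrm C (snd (\<sigma> n) - y) < e / 2"
        using conjunct2[OF x[unfolded B.ms.limit_metric_sequentially], rule_format, OF half_gt_zero[OF e]]
          conjunct2[OF y[unfolded C.ms.limit_metric_sequentially], rule_format, OF half_gt_zero[OF e]]
        unfolding eventually_sequentially by auto
      then show ?thesis
        by eventually_elim (use mem in \<open>auto simp: nrm mem_Times_iff\<close>)
    qed
    then have "limitin (norm_topology (direct_sum B C)) \<sigma> (x, y) sequentially"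
      using x y unfolding P.ms.limitin_metric B.ms.limitin_metric C.ms.limitin_metric by (auto simp: vecs)
    then show "\<exists>x. limitin (norm_topology (direct_sum B C)) \<sigma> x sequentially" by blast
  qed
qed

lemma bounded_clinear_fst:
  assumes "complex_normed_space B" "complex_normed_space C"
  shows "bounded_clinear (direct_sum B C) B fst"
  using complex_normed_space.nrm_nonneg[OF assms(2)]
  by (auto simp: bounded_clinear_def direct_sum_def intro!: exI[of _ 1])

lemma bounded_clinear_snd:
  assumes "complex_normed_space B" "complex_normed_space C"
  shows "bounded_clinear (direct_sum B C) C snd"
  using complex_normed_space.nrm_nonneg[OF assms(1)]
  by (auto simp: bounded_clinear_def direct_sum_def intro!: exI[of _ 1])

lemma bounded_clinear_map_prod:
  assumes "complex_normed_space B" "complex_normed_space C"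
    and S: "bounded_clinear B B S" and T: "bounded_clinear C C T"
  shows "bounded_clinear (direct_sum B C) (direct_sum B C) (map_prod S T)"
proof -
  obtain K where K: "K > 0" "\<And>x. x \<in> vecs B \<Longrightarrow> nrm B (S x) \<le> K * nrm B x"
    using bounded_clinear_bound assms(1) S by blast
  obtain L where L: "L > 0" "\<And>x. x \<in> vecs C \<Longrightarrow> nrm C (T x) \<le> L * nrm C x"
    using bounded_clinear_bound assms(2) T by blast
  interpret B: complex_normed_space B by fact
  interpret C: complex_normed_space C by fact
  have "nrm B (S x) + nrm C (T y) \<le> (K + L) * (nrm B x + nrm C y)"
    if "x \<in> vecs B" "y \<in> vecs C" for x y
  proof -
    have "0 \<le> K * nrm C y + L * nrm B x" using K L B.nrm_nonneg C.nrm_nonneg by simp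
    then show ?thesis using K(2)[OF that(1)] L(2)[OF that(2)] by (simp add: algebra_simps)
  qed
  then show ?thesis
    using S T unfolding bounded_clinear_def
    by (auto simp: direct_sum_def intro!: exI[of _ "K + L"])
qed

text \<open>
  The exponents of the criterion do not depend on the vectors, so one sequence serves both summands.
\<close>

lemma supercyclicity_criterion_direct_sum:
  assumes B: "complex_normed_space B" and crit: "supercyclicity_criterion B T"
  shows "supercyclicity_criterion (direct_sum B B) (map_prod T T)"
proof -
  obtain m E F S where m: "strict_mono m" "\<forall>k. 0 < m k"
    and EF: "norm_dense B E" "norm_dense B F" and S: "S ` F \<subseteq> F" "\<forall>y\<in>F. T (S y) = y"
    and lim: "\<forall>x\<in>E. \<forall>y\<in>F. (\<lambda>k. nrm B ((T ^^ m k) x) * nrm B ((S ^^ m k) y)) \<longlonglongrightarrow> 0"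
    using crit unfolding supercyclicity_criterion_def by blast
  have "(\<lambda>k. nrm (direct_sum B B) ((map_prod T T ^^ m k) x) * nrm (direct_sum B B) ((map_prod S S ^^ m k) y)) \<longlonglongrightarrow> 0"
    if xy: "x \<in> E \<times> E" "y \<in> F \<times> F" for x y
  proof -
    obtain x1 x2 y1 y2 where xy': "x = (x1, x2)" "y = (y1, y2)" "x1 \<in> E" "x2 \<in> E" "y1 \<in> F" "y2 \<in> F"
      using xy by auto
    have "(\<lambda>k. (nrm B ((T ^^ m k) x1) * nrm B ((S ^^ m k) y1) + nrm B ((T ^^ m k) x1) * nrm B ((S ^^ m k) y2))
      + (nrm B ((T ^^ m k) x2) * nrm B ((S ^^ m k) y1) + nrm B ((T ^^ m k) x2) * nrm B ((S ^^ m k) y2))) \<longlonglongrightarrow> 0"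
      by (intro tendsto_add_zero lim[rule_format] xy')
    then show ?thesis by (simp add: funpow_map_prod direct_sum_def xy' algebra_simps)
  qed
  then show ?thesis
    unfolding supercyclicity_criterion_def
    using m S norm_dense_direct_sum[OF B B EF(1,1)] norm_dense_direct_sum[OF B B EF(2,2)]
    by (intro exI[of _ m] exI[of _ "E \<times> E"] exI[of _ "F \<times> F"] exI[of _ "map_prod S S"]) auto
qed

section \<open>The sequence spaces\<close>

lemma vecs_ell: "x \<in> vecs (ell p) \<longleftrightarrow> (\<lambda>n. cmod (x n) powr p) summable_on UNIV"
  by (simp add: ell_def)

lemma scl_ell: "scl (ell p) c x = (\<lambda>n. c * x n)"
  by (simp add: ell_def)

lemma nrm_ell_powr:
  assumes "1 \<le> p"
  shows "nrm (ell p) x powr p = (\<Sum>\<^sub>\<infinity>n. cmod (x n) powr p)"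
  using assms by (simp add: ell_def powr_powr infsum_nonneg)

lemma sum_le_nrm_ell:
  assumes "1 \<le> p" "x \<in> vecs (ell p)" "finite A"
  shows "(\<Sum>n\<in>A. cmod (x n) powr p) \<le> nrm (ell p) x powr p"
  unfolding nrm_ell_powr[OF assms(1)]
  by (rule finite_sum_le_infsum) (use assms in \<open>auto simp: vecs_ell\<close>)

text \<open>
  Membership and norm bounds both come from bounds on finite partial sums, which avoids infinite sums
  wherever a limit or an approximation is estimated.
\<close>

lemma ell_bounded_sums:
  assumes "1 \<le> p" "0 \<le> r" "\<And>A. finite A \<Longrightarrow> (\<Sum>n\<in>A. cmod (x n) powr p) \<le> r powr p"
  shows "x \<in> vecs (ell p)" and "nrm (ell p) x \<le> r"
proof -
  have s: "(\<lambda>n. cmod (x n) powr p) summable_on UNIV"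
    by (rule nonneg_bdd_above_summable_on) (use assms(3) in \<open>auto intro!: bdd_aboveI\<close>)
  then show "x \<in> vecs (ell p)" by (simp add: vecs_ell)
  have "(\<Sum>\<^sub>\<infinity>n. cmod (x n) powr p) \<le> r powr p"
    by (rule infsum_le_finite_sums[OF s assms(3)])
  then have "nrm (ell p) x \<le> (r powr p) powr (1 / p)"
    using assms(1) by (auto simp: ell_def infsum_nonneg intro!: powr_mono2)
  also have "\<dots> = r" using assms by (simp add: powr_powr)
  finally show "nrm (ell p) x \<le> r" .
qed

lemma norm_coordinate_le_nrm_ell:
  assumes "1 \<le> p" "x \<in> vecs (ell p)"
  shows "cmod (x n) \<le> nrm (ell p) x"
proof -
  interpret complex_normed_space "ell p" using complex_normed_space_ell[OF assms(1)] .
  have "cmod (x n) powr p \<le> nrm (ell p) x powr p"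
    using sum_le_nrm_ell[OF assms, of "{n}"] by simp
  moreover have "nrm (ell p) x powr p < cmod (x n) powr p" if "nrm (ell p) x < cmod (x n)"
    using that assms(1) nrm_nonneg by (intro powr_less_mono2) auto
  ultimately show ?thesis by force
qed

lemma bounded_clinear_coordinate:
  assumes "1 \<le> p"
  shows "bounded_clinear (ell p) scalars (\<lambda>x. x n)"
  unfolding bounded_clinear_def using norm_coordinate_le_nrm_ell[OF assms]
  by (auto simp: scalars_def scl_ell intro!: exI[of _ 1])

lemma mcomplete_ell:
  assumes p: "1 \<le> p"
  shows "Metric_space.mcomplete (vecs (ell p)) (\<lambda>x y. nrm (ell p) (x - y))"
proof -
  interpret complex_normed_space "ell p" using complex_normed_space_ell[OF p] .
  show ?thesis
    unfolding ms.mcomplete_def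
  proof (intro allI impI)
    fix \<sigma> assume "ms.MCauchy \<sigma>"
    then have mem: "\<sigma> k \<in> vecs (ell p)"
      and cau: "\<And>e. e > 0 \<Longrightarrow> \<exists>N. \<forall>k l. N \<le> k \<longrightarrow> N \<le> l \<longrightarrow> nrm (ell p) (\<sigma> k - \<sigma> l) < e" for k
      unfolding ms.MCauchy_def by auto
    have "Cauchy (\<lambda>k. \<sigma> k n)" for n
      unfolding Cauchy_def
    proof (intro allI impI)
      fix e :: real assume "e > 0"
      then obtain N where N: "\<forall>k l. N \<le> k \<longrightarrow> N \<le> l \<longrightarrow> nrm (ell p) (\<sigma> k - \<sigma> l) < e"
        using cau by blast
      have "dist (\<sigma> k n) (\<sigma> l n) \<le> nrm (ell p) (\<sigma> k - \<sigma> l)" for k l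
        using norm_coordinate_le_nrm_ell[OF p diff_mem[OF mem mem], of k l n]
        by (simp add: dist_norm)
      then show "\<exists>N. \<forall>k\<ge>N. \<forall>l\<ge>N. dist (\<sigma> k n) (\<sigma> l n) < e"
        using N by (meson le_less_trans)
    qed
    then have "\<forall>n. \<exists>l. (\<lambda>k. \<sigma> k n) \<longlonglongrightarrow> l"
      using Cauchy_convergent unfolding convergent_def by blast
    from choice[OF this] obtain x where x: "(\<lambda>k. \<sigma> k n) \<longlonglongrightarrow> x n" for n by blast
    have close: "\<exists>N. \<forall>k\<ge>N. \<sigma> k - x \<in> vecs (ell p) \<and> nrm (ell p) (\<sigma> k - x) \<le> e"
      if e: "e > 0" for e
    proof -
      obtain N where N: "\<forall>k l. N \<le> k \<longrightarrow> N \<le> l \<longrightarrow> nrm (ell p) (\<sigma> k - \<sigma> l) < e"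
        using cau e by blast
      have bound: "(\<Sum>n\<in>A. cmod ((\<sigma> k - x) n) powr p) \<le> e powr p" if k: "k \<ge> N" and A: "finite A" for k A
      proof (rule LIMSEQ_le_const2)
        show "(\<lambda>l. \<Sum>n\<in>A. cmod ((\<sigma> k - \<sigma> l) n) powr p) \<longlonglongrightarrow> (\<Sum>n\<in>A. cmod ((\<sigma> k - x) n) powr p)"
          using p x by (auto intro!: tendsto_sum tendsto_powr' tendsto_norm tendsto_diff)
        have "(\<Sum>n\<in>A. cmod ((\<sigma> k - \<sigma> l) n) powr p) \<le> e powr p" if l: "l \<ge> N" for l
        proof -
          have "(\<Sum>n\<in>A. cmod ((\<sigma> k - \<sigma> l) n) powr p) \<le> nrm (ell p) (\<sigma> k - \<sigma> l) powr p"
            by (rule sum_le_nrm_ell[OF p diff_mem[OF mem mem] A])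
          also have "\<dots> \<le> e powr p"
            using N k l p nrm_nonneg by (intro powr_mono2) (auto intro: less_imp_le)
          finally show ?thesis .
        qed
        then show "\<exists>N. \<forall>l\<ge>N. (\<Sum>n\<in>A. cmod ((\<sigma> k - \<sigma> l) n) powr p) \<le> e powr p" by blast
      qed
      show ?thesis
        using ell_bounded_sums[OF p less_imp_le[OF e] bound] by blast
    qed
    obtain k where "\<sigma> k - x \<in> vecs (ell p)" using close[of 1] by auto
    then have xV: "x \<in> vecs (ell p)" using diff_mem[OF mem[of k]] by force
    have "\<exists>N. \<forall>k\<ge>N. nrm (ell p) (\<sigma> k - x) < e" if e: "e > 0" for e
    proof -
      obtain N where "\<forall>k\<ge>N. nrm (ell p) (\<sigma> k - x) \<le> e / 2"
        using close[OF half_gt_zero[OF e]] by blast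
      then show ?thesis using e by (intro exI[of _ N]) force
    qed
    then have "limitin (norm_topology (ell p)) \<sigma> x sequentially"
      using xV mem unfolding ms.limit_metric_sequentially by blast
    then show "\<exists>x. limitin (norm_topology (ell p)) \<sigma> x sequentially" by blast
  qed
qed

definition finsupp :: "(int \<Rightarrow> complex) set" where
  "finsupp = {x. finite {n. x n \<noteq> 0}}"

lemma sum_fun_apply: "(\<Sum>i\<in>A. f i) n = (\<Sum>i\<in>A. f i n)"
  by (induction A rule: infinite_finite_induct) auto

lemma unit_seq_ell:
  assumes "1 \<le> p"
  shows "unit_seq n \<in> vecs (ell p)" and "nrm (ell p) (unit_seq n) \<le> 1"
proof -
  have "(\<Sum>k\<in>A. cmod (unit_seq n k) powr p) \<le> 1 powr p" if "finite A" for A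
  proof -
    have "(\<Sum>k\<in>A. cmod (unit_seq n k) powr p) = (\<Sum>k\<in>A. if k = n then 1 else 0)"
      using assms by (intro sum.cong) (auto simp: unit_seq_def)
    then show ?thesis using that by simp
  qed
  from ell_bounded_sums[OF assms _ this]
  show "unit_seq n \<in> vecs (ell p)" "nrm (ell p) (unit_seq n) \<le> 1" by auto
qed

lemma finite_support_expansion:
  assumes "finite A" "\<And>n. n \<notin> A \<Longrightarrow> x n = 0"
  shows "x = (\<Sum>n\<in>A. scl (ell p) (x n) (unit_seq n))"
proof
  fix k
  have "(\<Sum>n\<in>A. scl (ell p) (x n) (unit_seq n)) k = (\<Sum>n\<in>A. if n = k then x k else 0)"
    unfolding sum_fun_apply by (intro sum.cong) (auto simp: scl_ell unit_seq_def)
  then show "x k = (\<Sum>n\<in>A. scl (ell p) (x n) (unit_seq n)) k" using assms by auto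
qed

lemma nrm_ell_le_sum:
  assumes p: "1 \<le> p" and A: "finite A" "\<And>n. n \<notin> A \<Longrightarrow> x n = 0"
  shows "x \<in> vecs (ell p)" and "nrm (ell p) x \<le> (\<Sum>n\<in>A. cmod (x n))"
proof -
  interpret complex_normed_space "ell p" using complex_normed_space_ell[OF p] .
  note x = finite_support_expansion[OF A, of _ p]
  show "x \<in> vecs (ell p)"
    by (subst x) (auto intro!: vs.subspace_sum[OF subspace] unit_seq_ell p)
  have "nrm (ell p) x \<le> (\<Sum>n\<in>A. nrm (ell p) (scl (ell p) (x n) (unit_seq n)))"
    by (subst x) (auto intro!: nrm_sum_le unit_seq_ell p)
  also have "\<dots> \<le> (\<Sum>n\<in>A. cmod (x n))"
    using unit_seq_ell[OF p] by (intro sum_mono) (simp add: nrm_scl mult_left_le)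
  finally show "nrm (ell p) x \<le> (\<Sum>n\<in>A. cmod (x n))" .
qed

lemma finsupp_subset_ell: "1 \<le> p \<Longrightarrow> finsupp \<subseteq> vecs (ell p)"
  using nrm_ell_le_sum(1) by (auto simp: finsupp_def)

text \<open>
  Cut off the tail of a sequence beyond a finite set and move the remaining entries into a countable
  dense subset of the complex numbers. Lists of index-value pairs witness the countability.
\<close>

lemma countable_dense_finsupp:
  assumes p: "1 \<le> p"
  obtains D where "countable D" "D \<subseteq> finsupp" "norm_dense (ell p) D"
proof -
  interpret complex_normed_space "ell p" using complex_normed_space_ell[OF p] .
  obtain Q :: "complex set" where Q: "countable Q" "\<And>X. open X \<Longrightarrow> X \<noteq> {} \<Longrightarrow> \<exists>d\<in>Q. d \<in> X"
    using countable_dense_setE by blast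
  define of_list :: "(int \<times> complex) list \<Rightarrow> int \<Rightarrow> complex"
    where "of_list l = (\<lambda>n. case map_of l n of None \<Rightarrow> 0 | Some c \<Rightarrow> c)" for l
  define D where "D = of_list ` lists (UNIV \<times> Q)"
  have "countable D" unfolding D_def using Q(1) by auto
  moreover have sub: "D \<subseteq> finsupp"
  proof -
    have "{n. of_list l n \<noteq> 0} \<subseteq> dom (map_of l)" for l
      by (auto simp: of_list_def split: option.splits)
    then show ?thesis
      unfolding D_def finsupp_def using finite_dom_map_of finite_subset by blast
  qed
  moreover have "norm_dense (ell p) D"
    unfolding norm_dense_iff
  proof (intro conjI ballI allI impI)
    show "D \<subseteq> vecs (ell p)" using sub finsupp_subset_ell[OF p] by blast
    fix x and e :: real assume x: "x \<in> vecs (ell p)" and e: "e > 0"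
    \<comment> \<open>One \<open>\<eta>\<close> pays for the tail outside A, the other one, shared equally, for the entries in A.\<close>
    define \<eta> where "\<eta> = (e / 2) powr p / 2"
    have \<eta>: "\<eta> > 0" using e by (simp add: \<eta>_def)
    let ?f = "\<lambda>n. cmod (x n) powr p"
    have sf: "?f summable_on UNIV" using x by (simp add: vecs_ell)
    obtain A where A: "finite A" "dist (sum ?f A) (infsum ?f UNIV) \<le> \<eta>"
      using infsum_finite_approximation[OF sf \<eta>] by blast
    define \<delta> where "\<delta> = (\<eta> / (card A + 1)) powr (1 / p)"
    have \<delta>: "\<delta> > 0" using \<eta> by (simp add: \<delta>_def)
    have "\<exists>c\<in>Q. dist (x n) c < \<delta>" for n
      using Q(2)[of "ball (x n) \<delta>"] \<delta> by auto
    then obtain r where r: "\<And>n. r n \<in> Q" "\<And>n. dist (x n) (r n) < \<delta>" by metis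
    define y where "y = (\<lambda>n. if n \<in> A then r n else 0)"
    obtain l where l: "set l = A" using A(1) finite_list by blast
    have "y = of_list (map (\<lambda>n. (n, r n)) l)"
      by (auto simp: y_def of_list_def map_of_map_restrict l restrict_map_def fun_eq_iff)
    then have "y \<in> D" unfolding D_def by (rule image_eqI) (use r(1) in auto)
    have bound: "(\<Sum>n\<in>F. cmod ((x - y) n) powr p) \<le> (e / 2) powr p" if F: "finite F" for F
    proof -
      have "(\<Sum>n\<in>F. cmod ((x - y) n) powr p) =
        (\<Sum>n\<in>F \<inter> A. cmod ((x - y) n) powr p) + (\<Sum>n\<in>F - A. cmod ((x - y) n) powr p)"
        using F by (rule sum.Int_Diff)
      also have "(\<Sum>n\<in>F - A. cmod ((x - y) n) powr p) = sum ?f (F - A)"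
        by (rule sum.cong) (auto simp: y_def)
      also have "(\<Sum>n\<in>F \<inter> A. cmod ((x - y) n) powr p) \<le> (\<Sum>n\<in>F \<inter> A. \<eta> / (card A + 1))"
      proof (rule sum_mono)
        fix n assume "n \<in> F \<inter> A"
        then have "cmod ((x - y) n) \<le> \<delta>" using r(2)[of n] by (simp add: y_def dist_norm)
        then have "cmod ((x - y) n) powr p \<le> \<delta> powr p" using p by (intro powr_mono2) auto
        also have "\<dots> = \<eta> / (card A + 1)" using p \<eta> by (simp add: \<delta>_def powr_powr)
        finally show "cmod ((x - y) n) powr p \<le> \<eta> / (card A + 1)" .
      qed
      also have "\<dots> \<le> \<eta>"
      proof -
        have "real (card (F \<inter> A)) \<le> real (card A + 1)"
          using card_mono[OF A(1), of "F \<inter> A"] by simp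
        then have "card (F \<inter> A) * \<eta> \<le> (card A + 1) * \<eta>" using \<eta> by (intro mult_right_mono) auto
        then show ?thesis by (simp add: field_simps)
      qed
      also have "sum ?f (F - A) \<le> \<eta>"
      proof -
        have "sum ?f (F - A) + sum ?f A = sum ?f (F \<union> A)"
          using F A(1) by (subst sum.union_disjoint[symmetric]) auto
        also have "\<dots> \<le> infsum ?f UNIV"
          by (rule finite_sum_le_infsum[OF sf]) (use F A in auto)
        finally show ?thesis using A(2) by (simp add: dist_real_def)
      qed
      finally show ?thesis by (simp add: \<eta>_def)
    qed
    have "nrm (ell p) (x - y) \<le> e / 2"
      by (rule ell_bounded_sums(2)[OF p _ bound]) (use e in auto)
    then have "nrm (ell p) (x - y) < e" using e by simp
    then show "\<exists>s\<in>D. nrm (ell p) (x - s) < e" using \<open>y \<in> D\<close> by blast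
  qed
  ultimately show ?thesis by (rule that)
qed

lemma norm_dense_finsupp: "1 \<le> p \<Longrightarrow> norm_dense (ell p) finsupp"
  by (metis complex_normed_space.norm_dense_mono complex_normed_space_ell countable_dense_finsupp
      finsupp_subset_ell)

lemma norm_dense_span_unit_seq:
  assumes p: "1 \<le> p"
  shows "norm_dense (ell p) (module.span (scl (ell p)) (range unit_seq))"
proof -
  interpret complex_normed_space "ell p" using complex_normed_space_ell[OF p] .
  have "finsupp \<subseteq> vs.span (range unit_seq)"
  proof
    fix x assume "x \<in> finsupp"
    then have "x = (\<Sum>n\<in>{n. x n \<noteq> 0}. scl (ell p) (x n) (unit_seq n))"
      by (intro finite_support_expansion) (auto simp: finsupp_def)
    also have "\<dots> \<in> vs.span (range unit_seq)"
      by (intro vs.span_sum vs.span_scale vs.span_base) auto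
    finally show "x \<in> vs.span (range unit_seq)" .
  qed
  moreover have "vs.span (range unit_seq) \<subseteq> vecs (ell p)"
    using unit_seq_ell[OF p] by (intro vs.span_minimal[OF _ subspace]) auto
  ultimately show ?thesis using norm_dense_mono[OF norm_dense_finsupp[OF p]] by blast
qed

text \<open>
  The operator is given on basis vectors only; continuity extends the coordinate formula to all vectors.
\<close>

lemma weighted_bilateral_shift_apply:
  assumes p: "1 \<le> p" and T: "weighted_bilateral_shift p w T" and x: "x \<in> vecs (ell p)"
  shows "T x = (\<lambda>n. w (n + 1) * x (n + 1))"
proof
  interpret complex_normed_space "ell p" using complex_normed_space_ell[OF p] .
  define R where "R = (\<lambda>x (n::int). w (n + 1) * x (n + 1))"
  have R: "weighted_bilateral_shift p w R"
    unfolding R_def using T by (intro weighted_bilateral_shift_exists p) (auto simp: weighted_bilateral_shift_def)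
  have lT: "bounded_clinear (ell p) (ell p) T" and lR: "bounded_clinear (ell p) (ell p) R"
    using T R by (auto simp: weighted_bilateral_shift_def)
  fix n
  have cT: "bounded_clinear (ell p) scalars (\<lambda>x. T x n)"
    and cR: "bounded_clinear (ell p) scalars (\<lambda>x. R x n)"
    using bounded_clinear_compose[OF complex_normed_space_axioms complex_normed_space_axioms _
        bounded_clinear_coordinate[OF p]] lT lR by blast+
  have "bounded_clinear (ell p) scalars (\<lambda>x. T x n - R x n)"
    by (rule bounded_clinear_minus[OF complex_normed_space_axioms complex_normed_space_scalars cT cR])
  then have "T x n - R x n = 0"
    by (rule bounded_clinear_eq_0_if_dense_span[OF complex_normed_space_axioms complex_normed_space_scalars
          _ norm_dense_span_unit_seq[OF p] _ _ x])
      (use T R unit_seq_ell[OF p] in \<open>auto simp: weighted_bilateral_shift_def\<close>)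
  then show "T x n = w (n + 1) * x (n + 1)" by (simp add: R_def)
qed

lemma powr_product_le_sum:
  fixes u v p :: real
  assumes "0 \<le> u" "u \<le> 1" "0 \<le> v" "v \<le> 1" "p \<le> 2"
  shows "u * v \<le> u powr p + v powr p"
proof -
  have sq: "t * t \<le> t powr p" if "0 \<le> t" "t \<le> 1" for t
  proof -
    have "t * t = t powr 2" using that by (simp add: power2_eq_square)
    also have "\<dots> \<le> t powr p" using that assms by (intro powr_mono') auto
    finally show ?thesis .
  qed
  have "u * v \<le> u * u + v * v" using assms mult_mono[of u v v v] mult_mono[of u u v u]
    by (cases "u \<le> v") (auto intro: add_increasing add_increasing2)
  then show ?thesis using sq[of u] sq[of v] assms by linarith
qed

text \<open>
  After normalisation every entry has modulus at most 1, where \<open>u * v \<le> u powr p + v powr p\<close> because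
  \<open>p \<le> 2\<close>. This replaces the Cauchy-Schwarz inequality in \<open>\<ell>\<^sub>2\<close>.
\<close>

lemma ell_pairing_sum_le:
  assumes p: "1 \<le> p" "p \<le> 2" and zy: "z \<in> vecs (ell p)" "y \<in> vecs (ell p)" and F: "finite F"
  shows "(\<Sum>j\<in>F. cmod (z j) * cmod (y (s - j))) \<le> 2 * nrm (ell p) z * nrm (ell p) y"
proof -
  interpret complex_normed_space "ell p" using complex_normed_space_ell[OF p(1)] .
  define N L where "N = nrm (ell p) z" and "L = nrm (ell p) y"
  note le = norm_coordinate_le_nrm_ell[OF p(1)]
  show ?thesis
  proof (cases "N = 0 \<or> L = 0")
    case True
    then have "cmod (z j) * cmod (y (s - j)) = 0" for j
      using le[OF zy(1), of j] le[OF zy(2), of "s - j"] by (auto simp: N_def L_def)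
    then have "(\<Sum>j\<in>F. cmod (z j) * cmod (y (s - j))) = 0" by (intro sum.neutral ballI)
    then show ?thesis using nrm_nonneg by simp
  next
    case False
    then have NL: "N > 0" "L > 0" using nrm_nonneg by (auto simp: N_def L_def less_le)
    have "(\<Sum>j\<in>F. cmod (z j) * cmod (y (s - j))) = N * L * (\<Sum>j\<in>F. (cmod (z j) / N) * (cmod (y (s - j)) / L))"
      using NL by (simp add: sum_distrib_left)
    also have "\<dots> \<le> N * L * (\<Sum>j\<in>F. (cmod (z j) / N) powr p + (cmod (y (s - j)) / L) powr p)"
      using NL le[OF zy(1)] le[OF zy(2)] p
      by (intro mult_left_mono sum_mono powr_product_le_sum) (auto simp: N_def L_def)
    also have "\<dots> = N * L * ((\<Sum>j\<in>F. cmod (z j) powr p) / N powr p + (\<Sum>j\<in>F. cmod (y (s - j)) powr p) / L powr p)"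
      using NL by (simp add: sum.distrib powr_divide sum_divide_distrib)
    also have "\<dots> \<le> N * L * (1 + 1)"
    proof (intro mult_left_mono add_mono)
      show "(\<Sum>j\<in>F. cmod (z j) powr p) / N powr p \<le> 1"
        using sum_le_nrm_ell[OF p(1) zy(1) F] NL by (simp add: N_def)
      have "(\<Sum>j\<in>F. cmod (y (s - j)) powr p) = (\<Sum>i\<in>(\<lambda>j. s - j) ` F. cmod (y i) powr p)"
        by (subst sum.reindex) (auto simp: inj_on_def)
      also have "\<dots> \<le> L powr p"
        unfolding L_def by (rule sum_le_nrm_ell[OF p(1) zy(2)]) (use F in auto)
      finally show "(\<Sum>j\<in>F. cmod (y (s - j)) powr p) / L powr p \<le> 1" using NL by simp
    qed (use NL in auto)
    finally show ?thesis by (simp add: N_def L_def)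
  qed
qed

text \<open>
  With \<open>a j = 1 / (b j * b (s - j))\<close> this is the bilinear form for which the shift is self-adjoint; other
  coefficients insert a sign pattern into it.
\<close>

definition reflected_pairing :: "(int \<Rightarrow> complex) \<Rightarrow> int \<Rightarrow> (int \<Rightarrow> complex) \<Rightarrow> (int \<Rightarrow> complex) \<Rightarrow> complex" where
  "reflected_pairing a s z y = (\<Sum>\<^sub>\<infinity>j. a j * z j * y (s - j))"

lemma abs_summable_reflected_pairing:
  assumes p: "1 \<le> p" "p \<le> 2" and zy: "z \<in> vecs (ell p)" "y \<in> vecs (ell p)"
    and a: "\<And>j. cmod (a j) \<le> K"
  shows "(\<lambda>j. norm (a j * z j * y (s - j))) summable_on UNIV"
    and "cmod (reflected_pairing a s z y) \<le> K * (2 * nrm (ell p) z * nrm (ell p) y)"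
proof -
  have K: "K \<ge> 0" using a[of 0] norm_ge_zero order_trans by blast
  have bound: "(\<Sum>j\<in>F. cmod (a j * z j * y (s - j))) \<le> K * (2 * nrm (ell p) z * nrm (ell p) y)"
    if F: "finite F" for F
  proof -
    have "(\<Sum>j\<in>F. cmod (a j * z j * y (s - j))) \<le> (\<Sum>j\<in>F. K * (cmod (z j) * cmod (y (s - j))))"
      using a by (intro sum_mono) (auto simp: norm_mult mult.assoc intro!: mult_right_mono)
    also have "\<dots> = K * (\<Sum>j\<in>F. cmod (z j) * cmod (y (s - j)))"
      by (simp add: sum_distrib_left)
    also have "\<dots> \<le> K * (2 * nrm (ell p) z * nrm (ell p) y)"
      using ell_pairing_sum_le[OF p zy F] K by (intro mult_left_mono)
    finally show ?thesis .
  qed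
  show *: "(\<lambda>j. norm (a j * z j * y (s - j))) summable_on UNIV"
    by (rule nonneg_bdd_above_summable_on) (use bound in \<open>auto intro!: bdd_aboveI\<close>)
  have "cmod (reflected_pairing a s z y) \<le> (\<Sum>\<^sub>\<infinity>j. cmod (a j * z j * y (s - j)))"
    unfolding reflected_pairing_def by (rule norm_infsum_bound[OF *])
  also have "\<dots> \<le> K * (2 * nrm (ell p) z * nrm (ell p) y)"
    by (rule infsum_le_finite_sums[OF * bound])
  finally show "cmod (reflected_pairing a s z y) \<le> K * (2 * nrm (ell p) z * nrm (ell p) y)" .
qed

lemma bounded_clinear_reflected_pairing:
  assumes p: "1 \<le> p" "p \<le> 2" and y: "y \<in> vecs (ell p)" and a: "\<And>j. cmod (a j) \<le> K"
  shows "bounded_clinear (ell p) scalars (\<lambda>z. reflected_pairing a s z y)"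
proof -
  have s: "(\<lambda>j. a j * z j * y (s - j)) summable_on UNIV" if "z \<in> vecs (ell p)" for z
    using abs_summable_reflected_pairing(1)[where K = K, OF p that y a] by (rule abs_summable_summable)
  have "reflected_pairing a s (u + v) y = reflected_pairing a s u y + reflected_pairing a s v y"
    if "u \<in> vecs (ell p)" "v \<in> vecs (ell p)" for u v
    unfolding reflected_pairing_def using infsum_add[OF s[OF that(1)] s[OF that(2)]]
    by (simp add: algebra_simps)
  moreover have "reflected_pairing a s (scl (ell p) c u) y = c * reflected_pairing a s u y" for c u
    unfolding reflected_pairing_def infsum_cmult_right'[symmetric]
    by (intro infsum_cong) (simp add: scl_ell)
  moreover have "cmod (reflected_pairing a s z y) \<le> (K * 2 * nrm (ell p) y) * nrm (ell p) z"
    if "z \<in> vecs (ell p)" for z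
    using abs_summable_reflected_pairing(2)[where K = K, OF p that y a] by (simp add: ac_simps)
  ultimately show ?thesis
    unfolding bounded_clinear_def scalars_def
    by (intro conjI ballI allI exI[of _ "K * 2 * nrm (ell p) y"]) auto
qed

lemma reflected_pairing_unit_seq: "reflected_pairing a s (unit_seq i) y = a i * y (s - i)"
proof -
  have "reflected_pairing a s (unit_seq i) y = (\<Sum>\<^sub>\<infinity>j\<in>{i}. a j * unit_seq i j * y (s - j))"
    unfolding reflected_pairing_def by (rule infsum_cong_neutral) (auto simp: unit_seq_def)
  then show ?thesis by (simp add: unit_seq_def)
qed

section \<open>Weighted shifts as unweighted shifts of a weighted space\<close>

text \<open>
  The \<open>n\<close>-step backward shift of the sequences \<open>x j / b j\<close>. Negative \<open>n\<close> gives the forward shift, the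
  inverse of the operator on all sequences.
\<close>

definition shift_by :: "(int \<Rightarrow> complex) \<Rightarrow> int \<Rightarrow> (int \<Rightarrow> complex) \<Rightarrow> int \<Rightarrow> complex" where
  "shift_by b n x = (\<lambda>j. b j / b (j + n) * x (j + n))"

lemma exists_shift_profile:
  fixes w :: "int \<Rightarrow> complex"
  assumes w: "\<And>j. w j \<noteq> 0"
  obtains b where "\<And>j. b j \<noteq> 0" "\<And>j. b (j - 1) = w j * b j"
proof
  define b where "b j = (if j \<ge> 0 then inverse (\<Prod>i\<in>{1..j}. w i) else (\<Prod>i\<in>{j+1..0}. w i))" for j :: int
  show "b j \<noteq> 0" for j using w by (simp add: b_def)
  show "b (j - 1) = w j * b j" for j
  proof (cases "j \<ge> 1")
    case True
    then have "{1..j} = insert j {1..j - 1}" by auto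
    then show ?thesis using True w by (simp add: b_def)
  next
    case False
    then have "{j..0} = insert j {j + 1..0}" by auto
    then show ?thesis using False by (auto simp: b_def)
  qed
qed

text \<open>
  The numbers \<open>b j\<close> are the norms, up to phase, of basis vectors that the shift permutes without weights.
  The bound \<open>K\<close> is at least 1 so that its powers increase.
\<close>

locale shift_profile =
  fixes p :: real and w :: "int \<Rightarrow> complex" and T :: "(int \<Rightarrow> complex) \<Rightarrow> (int \<Rightarrow> complex)"
    and b :: "int \<Rightarrow> complex" and K :: real
  assumes p_ge_1: "1 \<le> p" and shift: "weighted_bilateral_shift p w T"
    and b_nonzero: "b j \<noteq> 0" and b_step: "b (j - 1) = w j * b j"
    and K_ge_1: "1 \<le> K" and norm_w_le: "cmod (w j) \<le> K"

sublocale shift_profile \<subseteq> complex_normed_space "ell p"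
  by (rule complex_normed_space_ell[OF p_ge_1])

text \<open>
  When the ratios \<open>b (j - 1) / b j\<close> are bounded, asking this around every centre \<open>q\<close> controls all
  products \<open>b (i - n) * b (j + n)\<close> with \<open>i\<close> and \<open>j\<close> in a bounded range.
\<close>

definition small_products :: "(int \<Rightarrow> complex) \<Rightarrow> bool" where
  "small_products b \<longleftrightarrow> (\<forall>q. \<forall>c>0. \<exists>n::nat. cmod (b (q - int n) * b (q + int n)) < c)"

context shift_profile
begin

lemma bounded_clinear_T: "bounded_clinear (ell p) (ell p) T"
  using shift by (simp add: weighted_bilateral_shift_def)

lemma funpow_T_mem: "x \<in> vecs (ell p) \<Longrightarrow> (T ^^ k) x \<in> vecs (ell p)"
  using bounded_clinear_mem[OF bounded_clinear_funpow[OF complex_normed_space_axioms bounded_clinear_T]] .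

lemma shift_by_0: "shift_by b 0 x = x"
  by (simp add: shift_by_def b_nonzero)

lemma shift_by_shift_by: "shift_by b m (shift_by b n x) = shift_by b (m + n) x"
  by (auto simp: shift_by_def b_nonzero fun_eq_iff add.assoc)

lemma funpow_shift_by: "(shift_by b n ^^ k) x = shift_by b (int k * n) x"
  by (induction k) (auto simp: shift_by_0 shift_by_shift_by algebra_simps)

lemma funpow_T: "x \<in> vecs (ell p) \<Longrightarrow> (T ^^ k) x = shift_by b (int k) x"
proof (induction k)
  case 0
  then show ?case by (simp add: shift_by_0)
next
  case (Suc k)
  have "(T ^^ Suc k) x = (\<lambda>n. w (n + 1) * ((T ^^ k) x) (n + 1))"
    using weighted_bilateral_shift_apply[OF p_ge_1 shift funpow_T_mem[OF Suc.prems]] by simp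
  also have "\<dots> = shift_by b (int (Suc k)) x"
  proof
    fix n
    have "w (n + 1) * b (n + 1) = b n" using b_step[of "n + 1"] by simp
    then have "w (n + 1) * (b (n + 1) / b (n + 1 + int k) * x (n + 1 + int k)) =
        b n / b (n + 1 + int k) * x (n + 1 + int k)"
      by (metis times_divide_eq_right mult.assoc)
    then show "w (n + 1) * ((T ^^ k) x) (n + 1) = shift_by b (int (Suc k)) x n"
      using Suc by (simp add: shift_by_def add.assoc)
  qed
  finally show ?case .
qed

lemma finsupp_shift_by:
  assumes "x \<in> finsupp"
  shows "shift_by b n x \<in> finsupp"
proof -
  have "{j. shift_by b n x j \<noteq> 0} \<subseteq> (\<lambda>i. i - n) ` {j. x j \<noteq> 0}"
  proof
    fix j assume "j \<in> {j. shift_by b n x j \<noteq> 0}"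
    then have "x (j + n) \<noteq> 0" by (auto simp: shift_by_def)
    then show "j \<in> (\<lambda>i. i - n) ` {j. x j \<noteq> 0}" by (intro image_eqI[of _ _ "j + n"]) auto
  qed
  then show ?thesis using assms unfolding finsupp_def by (auto intro: finite_subset)
qed

lemma nrm_shift_by_le:
  assumes A: "finite A" "\<And>n. n \<notin> A \<Longrightarrow> x n = 0"
  shows "nrm (ell p) (shift_by b n x) \<le> (\<Sum>i\<in>A. cmod (x i / b i) * cmod (b (i - n)))"
proof -
  have "nrm (ell p) (shift_by b n x) \<le> (\<Sum>j\<in>(\<lambda>i. i - n) ` A. cmod (shift_by b n x j))"
  proof (rule nrm_ell_le_sum(2)[OF p_ge_1])
    show "shift_by b n x j = 0" if "j \<notin> (\<lambda>i. i - n) ` A" for j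
    proof -
      have "j + n \<notin> A" using that by force
      then show ?thesis using A(2) by (simp add: shift_by_def)
    qed
  qed (use A in auto)
  also have "\<dots> = (\<Sum>i\<in>A. cmod (x i / b i) * cmod (b (i - n)))"
    by (subst sum.reindex) (auto simp: inj_on_def shift_by_def norm_mult norm_divide intro!: sum.cong)
  finally show ?thesis .
qed

text \<open>
  Moving an index to the left by one multiplies \<open>b\<close> by a weight, hence by at most \<open>K\<close> in modulus.
\<close>

lemma norm_b_mono:
  assumes "i \<le> j" "j - i \<le> int r"
  shows "cmod (b i) \<le> K ^ r * cmod (b j)"
proof -
  have step: "cmod (b (j - int k)) \<le> K ^ k * cmod (b j)" for k
  proof (induction k)
    case (Suc k)
    have "cmod (b (j - int (Suc k))) = cmod (w (j - int k)) * cmod (b (j - int k))"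
      using b_step[of "j - int k"] by (simp add: norm_mult algebra_simps)
    also have "\<dots> \<le> K * (K ^ k * cmod (b j))"
      using Suc norm_w_le K_ge_1 by (intro mult_mono) auto
    finally show ?case by simp
  qed simp
  have "cmod (b i) \<le> K ^ nat (j - i) * cmod (b j)" using step[of "nat (j - i)"] assms by simp
  also have "\<dots> \<le> K ^ r * cmod (b j)"
    using assms K_ge_1 by (intro mult_right_mono power_increasing) auto
  finally show ?thesis .
qed

section \<open>Small products give the Supercyclicity Criterion\<close>

text \<open>
  The finitely many products with small index are nonzero, so a bound below their minimum forces a
  large index.
\<close>

lemma small_products_large_index:
  assumes "small_products b" "c > 0"
  shows "\<exists>n\<ge>n0. cmod (b (q - int n) * b (q + int n)) < c"
proof -
  define f where "f n = cmod (b (q - int n) * b (q + int n))" for n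
  define c' where "c' = Min (insert c (f ` {..<n0}))"
  have "c' > 0" using assms(2) b_nonzero by (auto simp: c'_def f_def)
  then obtain n where n: "f n < c'" using assms(1) unfolding small_products_def f_def by blast
  then have "f n < c" by (simp add: c'_def)
  moreover have "n \<ge> n0"
  proof (rule ccontr)
    assume "\<not> n \<ge> n0"
    then have "c' \<le> f n" unfolding c'_def by (intro Min_le) auto
    then show False using n by simp
  qed
  ultimately show ?thesis unfolding f_def by blast
qed

text \<open>
  Find a small product around the centre \<open>l + N\<close> at some index \<open>n'\<close> and round \<open>n'\<close> up to the next
  multiple of \<open>N\<close>. The centre lies so far to the right that every index that occurs is at most the
  corresponding index of the small product, so only powers of \<open>K\<close> are lost.
\<close>

lemma small_products_uniform:
  assumes small: "small_products b" and N: "N \<ge> 1" and c: "c > 0"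
  shows "\<exists>n>n0. \<forall>i j. \<bar>i\<bar> \<le> int l \<longrightarrow> \<bar>j\<bar> \<le> int l \<longrightarrow>
    cmod (b (i - int (N * n)) * b (j + int (N * n))) < c"
proof -
  define r where "r = 2 * l + 2 * N"
  define q where "q = int l + int N"
  have Kr: "K ^ r > 0" using K_ge_1 by simp
  obtain n' where n': "n' \<ge> N * Suc n0" "cmod (b (q - int n') * b (q + int n')) < c / (K ^ r * K ^ r)"
    using small_products_large_index[OF small, of "c / (K ^ r * K ^ r)"] c Kr by (metis divide_pos_pos mult_pos_pos)
  define n where "n = Suc (n' div N)"
  have "n' div N \<ge> Suc n0" using n'(1) N by (simp add: less_eq_div_iff_mult_less_eq mult.commute)
  then have "n > n0" by (simp add: n_def)
  have "N * n = N * (n' div N) + N" by (simp add: n_def)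
  moreover have "N * (n' div N) + n' mod N = n'" by simp
  moreover have "n' mod N < N" using N by simp
  ultimately have Nn: "n' < N * n" "N * n \<le> n' + N" by linarith+
  have "cmod (b (i - int (N * n)) * b (j + int (N * n))) < c" if "\<bar>i\<bar> \<le> int l" "\<bar>j\<bar> \<le> int l" for i j
  proof -
    have "cmod (b (i - int (N * n))) \<le> K ^ r * cmod (b (q - int n'))"
      using that Nn by (intro norm_b_mono) (auto simp: q_def r_def simp del: of_nat_mult)
    moreover have "cmod (b (j + int (N * n))) \<le> K ^ r * cmod (b (q + int n'))"
      using that Nn by (intro norm_b_mono) (auto simp: q_def r_def simp del: of_nat_mult)
    ultimately have "cmod (b (i - int (N * n)) * b (j + int (N * n))) \<le>
        (K ^ r * cmod (b (q - int n'))) * (K ^ r * cmod (b (q + int n')))"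
      unfolding norm_mult using Kr by (intro mult_mono) auto
    also have "\<dots> < c" using n'(2) Kr by (simp add: norm_mult field_simps)
    finally show ?thesis .
  qed
  then show ?thesis using \<open>n > n0\<close> by blast
qed

text \<open>
  The dense sets are the finitely supported sequences, on which the forward shift is a right inverse.
  The product of the two norms is bounded by a finite combination of the moduli of
  \<open>b (i - N * n) * b (j + N * n)\<close>.
\<close>

lemma supercyclicity_criterion_power:
  assumes small: "small_products b" and N: "N \<ge> 1"
  shows "supercyclicity_criterion (ell p) (T ^^ N)"
proof -
  let ?P = "\<lambda>k n. n > 0 \<and> (\<forall>i j. \<bar>i\<bar> \<le> int k \<longrightarrow> \<bar>j\<bar> \<le> int k \<longrightarrow>
    cmod (b (i - int (N * n)) * b (j + int (N * n))) < inverse (real (Suc k)))"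
  have "\<exists>m. \<forall>k. ?P k (m k) \<and> m k < m (Suc k)"
  proof (rule dependent_nat_choice)
    show "\<exists>n. ?P 0 n" using small_products_uniform[OF small N, of "inverse (real (Suc 0))" 0 0] by auto
    show "\<exists>n'. ?P (Suc k) n' \<and> n < n'" for n k
      using small_products_uniform[OF small N, of "inverse (real (Suc (Suc k)))" n "Suc k"]
      by (metis inverse_positive_iff_positive not_less_zero gr0I of_nat_0_less_iff zero_less_Suc)
  qed
  then obtain m where m: "\<And>k. ?P k (m k)" "\<And>k. m k < m (Suc k)" by blast
  define S where "S = shift_by b (- int N)"
  have T_pow: "((T ^^ N) ^^ n) x = shift_by b (int (N * n)) x" if "x \<in> finsupp" for x n
    using that finsupp_subset_ell[OF p_ge_1] funpow_T[of x "N * n"] by (auto simp: funpow_mult)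
  have S_pow: "(S ^^ n) y = shift_by b (- int (N * n)) y" for y n
    by (simp add: S_def funpow_shift_by mult.commute)
  have TS: "(T ^^ N) (S y) = y" if "y \<in> finsupp" for y
    using T_pow[of "S y" 1] finsupp_shift_by[OF that] by (simp add: S_def shift_by_shift_by shift_by_0)
  have lim: "(\<lambda>k. nrm (ell p) (((T ^^ N) ^^ m k) x) * nrm (ell p) ((S ^^ m k) y)) \<longlonglongrightarrow> 0"
    if x: "x \<in> finsupp" and y: "y \<in> finsupp" for x y
  proof (rule tendsto_sandwich[OF _ _ tendsto_const])
    let ?A = "{n. x n \<noteq> 0}" and ?B = "{n. y n \<noteq> 0}"
    let ?g = "\<lambda>k i j. (cmod (x i / b i) * cmod (y j / b j)) * cmod (b (i - int (N * m k)) * b (j + int (N * m k)))"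
    have "nrm (ell p) (((T ^^ N) ^^ m k) x) * nrm (ell p) ((S ^^ m k) y) \<le> (\<Sum>i\<in>?A. \<Sum>j\<in>?B. ?g k i j)" for k
    proof -
      have "nrm (ell p) (((T ^^ N) ^^ m k) x) * nrm (ell p) ((S ^^ m k) y) \<le>
         (\<Sum>i\<in>?A. cmod (x i / b i) * cmod (b (i - int (N * m k)))) *
         (\<Sum>i\<in>?B. cmod (y i / b i) * cmod (b (i - - int (N * m k))))"
        unfolding T_pow[OF x] S_pow using x y
        by (intro mult_mono nrm_shift_by_le) (auto simp: finsupp_def nrm_nonneg intro!: sum_nonneg)
      also have "\<dots> = (\<Sum>i\<in>?A. \<Sum>j\<in>?B. ?g k i j)"
        unfolding sum_product by (simp add: norm_mult mult_ac)
      finally show ?thesis .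
    qed
    then show "\<forall>\<^sub>F k in sequentially. nrm (ell p) (((T ^^ N) ^^ m k) x) * nrm (ell p) ((S ^^ m k) y)
        \<le> (\<Sum>i\<in>?A. \<Sum>j\<in>?B. ?g k i j)" by simp
    have "(\<lambda>k. cmod (b (i - int (N * m k)) * b (j + int (N * m k)))) \<longlonglongrightarrow> 0" for i j
    proof (rule tendsto_sandwich[OF _ _ tendsto_const LIMSEQ_inverse_real_of_nat])
      show "\<forall>\<^sub>F k in sequentially. cmod (b (i - int (N * m k)) * b (j + int (N * m k))) \<le> inverse (real (Suc k))"
      proof (rule eventually_sequentiallyI)
        fix k assume "k \<ge> nat (\<bar>i\<bar> + \<bar>j\<bar>)"
        then show "cmod (b (i - int (N * m k)) * b (j + int (N * m k))) \<le> inverse (real (Suc k))"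
          using m(1)[of k] by (intro less_imp_le) auto
      qed
    qed simp
    then show "(\<lambda>k. \<Sum>i\<in>?A. \<Sum>j\<in>?B. ?g k i j) \<longlonglongrightarrow> 0"
      by (intro tendsto_null_sum tendsto_mult_right_zero)
    show "\<forall>\<^sub>F k in sequentially. 0 \<le> nrm (ell p) (((T ^^ N) ^^ m k) x) * nrm (ell p) ((S ^^ m k) y)"
      by (simp add: nrm_nonneg)
  qed
  show ?thesis
    unfolding supercyclicity_criterion_def
  proof (intro exI conjI ballI allI)
    show "strict_mono m" using m(2) by (rule strict_monoI_Suc)
    show "0 < m k" for k using m(1) by blast
    show "norm_dense (ell p) finsupp" "norm_dense (ell p) finsupp"
      using norm_dense_finsupp[OF p_ge_1] by auto
    show "S ` finsupp \<subseteq> finsupp" using finsupp_shift_by by (auto simp: S_def)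
  qed (use TS lim in auto)
qed

section \<open>Annihilating functionals when the products stay away from zero\<close>

text \<open>
  The substitution of \<open>s - k - j\<close> for \<open>j\<close>. For constant \<open>e\<close> it says that the form is symmetric and the
  shift self-adjoint; a sign pattern \<open>e\<close> is reflected along the way.
\<close>

lemma reflected_pairing_shift_swap:
  "reflected_pairing (\<lambda>j. e j / (b j * b (s - j))) s (shift_by b k x) y =
   reflected_pairing (\<lambda>j. e (s - k - j) / (b j * b (s - j))) s (shift_by b k y) x"
proof -
  have bij: "bij_betw (\<lambda>j. s - k - j) UNIV UNIV"
    by (rule bij_betwI[where g = "\<lambda>j. s - k - j"]) auto
  define g where "g j = e (s - k - j) / (b j * b (s - j)) * shift_by b k y j * x (s - j)" for j
  have "e j / (b j * b (s - j)) * shift_by b k x j * y (s - j) = g (s - k - j)" for j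
  proof -
    have "s - k - (s - k - j) = j" "s - (s - k - j) = j + k" "s - k - j + k = s - j" by auto
    then show ?thesis by (simp add: g_def shift_by_def b_nonzero mult_ac add.commute)
  qed
  then have "reflected_pairing (\<lambda>j. e j / (b j * b (s - j))) s (shift_by b k x) y = (\<Sum>\<^sub>\<infinity>j. g (s - k - j))"
    by (simp add: reflected_pairing_def)
  also have "\<dots> = (\<Sum>\<^sub>\<infinity>j. g j)" by (rule infsum_reindex_bij_betw[OF bij])
  finally show ?thesis by (simp add: reflected_pairing_def g_def)
qed

text \<open>
  A lower bound around the centre \<open>q\<close> is the case of the even reflection \<open>j \<mapsto> 2 * q - j\<close>. The odd
  reflection follows at the price of a factor \<open>K\<close>, since it moves one index to the right.
\<close>

lemma not_small_products_lower_bound: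
  assumes "\<not> small_products b"
  obtains q c where "c > 0" "\<And>j. c \<le> cmod (b j * b (2 * q - j))" "\<And>j. c \<le> cmod (b j * b (2 * q + 1 - j))"
proof -
  obtain q c where c: "c > 0" and le: "\<And>n::nat. c \<le> cmod (b (q - int n) * b (q + int n))"
    using assms unfolding small_products_def by (metis not_le)
  have even: "c \<le> cmod (b j * b (2 * q - j))" for j
  proof (cases "j \<le> q")
    case True
    then show ?thesis using le[of "nat (q - j)"] by (simp add: algebra_simps)
  next
    case False
    then show ?thesis using le[of "nat (j - q)"] by (simp add: algebra_simps)
  qed
  have odd: "c / K \<le> cmod (b j * b (2 * q + 1 - j))" for j
  proof -
    have "c \<le> cmod (b j) * cmod (b (2 * q - j))" using even[of j] by (simp add: norm_mult)
    also have "\<dots> \<le> cmod (b j) * (K ^ 1 * cmod (b (2 * q + 1 - j)))"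
      by (intro mult_left_mono norm_b_mono) auto
    finally show ?thesis using K_ge_1 by (simp add: norm_mult field_simps)
  qed
  have "c / K \<le> c" using c K_ge_1 by (simp add: field_simps)
  then show ?thesis
    using that[of "c / K" q] c K_ge_1 even odd by (meson divide_pos_pos less_le_trans order_trans zero_less_one)
qed

end

locale shift_profile_le_2 = shift_profile +
  assumes p_le_2: "p \<le> 2"
begin

text \<open>
  The coefficients \<open>e\<close> are 1 on the class of \<open>q\<close>, -1 on that of \<open>q + 1\<close> and 0 elsewhere. Reflection about
  \<open>q + 1 / 2\<close>, combined with a translation by a multiple of \<open>N\<close>, changes their sign, so the value of the
  functional on the orbit equals its own negative. The functional is zero only if \<open>x\<close> vanishes on both
  classes, and then a coordinate in one of them annihilates the orbit.
\<close>

lemma exists_annihilating_functional: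
  assumes big: "\<not> small_products b" and N: "N \<ge> 2" and x: "x \<in> vecs (ell p)"
  obtains f z where "bounded_clinear (ell p) scalars f" "z \<in> vecs (ell p)" "f z \<noteq> 0"
    "\<And>k. f ((T ^^ (N * k)) x) = 0"
proof -
  obtain q c where c: "c > 0" and le: "\<And>j. c \<le> cmod (b j * b (2 * q + 1 - j))"
    using not_small_products_lower_bound[OF big] by metis
  define e :: "int \<Rightarrow> complex"
    where "e j = of_bool (int N dvd j - q) - of_bool (int N dvd j - q - 1)" for j
  define s where "s = 2 * q + 1"
  define a where "a = (\<lambda>j. e j / (b j * b (s - j)))"
  show ?thesis
  proof (cases "\<exists>i. e i \<noteq> 0 \<and> x (s - i) \<noteq> 0")
    case True
    then obtain i where i: "e i \<noteq> 0" "x (s - i) \<noteq> 0" by blast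
    have "cmod (a j) \<le> 1 / c" for j
    proof -
      have "cmod (e j) \<le> 1" by (simp add: e_def)
      then have "cmod (a j) \<le> 1 / cmod (b j * b (s - j))"
        unfolding a_def norm_divide by (intro divide_right_mono) auto
      also have "\<dots> \<le> 1 / c" using le[of j] c by (intro frac_le) (auto simp: s_def)
      finally show ?thesis .
    qed
    then have lin: "bounded_clinear (ell p) scalars (\<lambda>z. reflected_pairing a s z x)"
      by (rule bounded_clinear_reflected_pairing[OF p_ge_1 p_le_2 x])
    have nz: "reflected_pairing a s (unit_seq i) x \<noteq> 0"
      using i by (simp add: reflected_pairing_unit_seq a_def b_nonzero)
    have zero: "reflected_pairing a s ((T ^^ (N * k)) x) x = 0" for k
    proof -
      \<comment> \<open>The two divisibility conditions defining e are exchanged.\<close>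
      have flip: "e (s - int (N * k) - j) = - e j" for j
      proof -
        have "s - int (N * k) - j - q = - (j - q - 1) - int N * int k"
          "s - int (N * k) - j - q - 1 = - (j - q) - int N * int k" by (auto simp: s_def)
        then have "int N dvd s - int (N * k) - j - q \<longleftrightarrow> int N dvd j - q - 1"
          "int N dvd s - int (N * k) - j - q - 1 \<longleftrightarrow> int N dvd j - q"
          by (metis dvd_diff_left_iff dvd_minus_iff dvd_triv_left)+
        then show ?thesis by (simp add: e_def)
      qed
      have "reflected_pairing a s ((T ^^ (N * k)) x) x =
        reflected_pairing (\<lambda>j. - a j) s ((T ^^ (N * k)) x) x"
        unfolding funpow_T[OF x] a_def
        by (subst reflected_pairing_shift_swap) (simp only: flip minus_divide_left)
      also have "\<dots> = - reflected_pairing a s ((T ^^ (N * k)) x) x"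
        by (simp add: reflected_pairing_def infsum_uminus)
      finally show ?thesis by simp
    qed
    show ?thesis by (rule that[OF lin unit_seq_ell(1)[OF p_ge_1] nz zero])
  next
    case False
    have "((T ^^ (N * k)) x) q = 0" for k
    proof -
      have "\<not> int N dvd 1" using N by (auto simp: zdvd1_eq)
      then have "\<not> int N dvd 1 - int N * int k" by (metis dvd_diff_left_iff dvd_triv_left)
      then have "e (q + 1 - int (N * k)) \<noteq> 0" by (simp add: e_def algebra_simps)
      then have "x (q + int (N * k)) = 0" using False by (force simp: s_def algebra_simps)
      then show ?thesis by (simp add: funpow_T[OF x] shift_by_def)
    qed
    then show ?thesis
      using that[OF bounded_clinear_coordinate[OF p_ge_1] unit_seq_ell(1)[OF p_ge_1], of q q]
      by (simp add: unit_seq_def)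
  qed
qed

lemma cyclic_power_imp_small_products:
  assumes "N \<ge> 2" "cyclic (ell p) (T ^^ N)"
  shows "small_products b"
proof (rule ccontr)
  assume big: "\<not> small_products b"
  obtain x where x: "x \<in> vecs (ell p)" "norm_dense (ell p) (vs.span {((T ^^ N) ^^ n) x | n. True})"
    using assms(2) by (auto simp: cyclic_def)
  obtain f z where f: "bounded_clinear (ell p) scalars f" "z \<in> vecs (ell p)" "f z \<noteq> 0"
    "\<And>k. f ((T ^^ (N * k)) x) = 0"
    using exists_annihilating_functional[OF big assms(1) x(1)] by blast
  have "f z = 0"
    by (rule bounded_clinear_eq_0_if_dense_span[OF complex_normed_space_axioms complex_normed_space_scalars f(1) x(2) _ _ f(2)])
      (use f(4) funpow_T_mem[OF x(1)] in \<open>auto simp: funpow_mult\<close>)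
  then show False using f(3) by simp
qed

text \<open>
  The scaled orbit splits into the scaled orbits of \<open>x\<close> and \<open>T x\<close> under \<open>T ^^ 2\<close>, each lying in the
  kernel of a nonzero functional.
\<close>

lemma weakly_supercyclic_imp_small_products:
  assumes "weakly_supercyclic (ell p) T"
  shows "small_products b"
proof (rule ccontr)
  assume big: "\<not> small_products b"
  obtain x where x: "x \<in> vecs (ell p)" "weakly_dense (ell p) {scl (ell p) c ((T ^^ n) x) | c n. True}"
    using assms by (auto simp: weakly_supercyclic_def)
  have Tx: "T x \<in> vecs (ell p)" using funpow_T_mem[OF x(1), of 1] by simp
  obtain f u where f: "bounded_clinear (ell p) scalars f" "u \<in> vecs (ell p)" "f u \<noteq> 0"
    "\<And>k. f ((T ^^ (2 * k)) x) = 0"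
    using exists_annihilating_functional[OF big order_refl x(1)] by blast
  obtain g v where g: "bounded_clinear (ell p) scalars g" "v \<in> vecs (ell p)" "g v \<noteq> 0"
    "\<And>k. g ((T ^^ (2 * k)) (T x)) = 0"
    using exists_annihilating_functional[OF big order_refl Tx] by blast
  define S where "S y = {scl (ell p) c ((T ^^ (2 * k)) y) | c k. True}" for y
  have "{scl (ell p) c ((T ^^ n) x) | c n. True} = S x \<union> S (T x)"
  proof (intro equalityI subsetI)
    fix y assume "y \<in> {scl (ell p) c ((T ^^ n) x) | c n. True}"
    then obtain c n where y: "y = scl (ell p) c ((T ^^ n) x)" by blast
    show "y \<in> S x \<union> S (T x)"
    proof (cases "even n")
      case True
      then show ?thesis using y by (auto simp: S_def elim!: evenE)
    next
      case False
      then obtain k where "n = Suc (2 * k)" by (auto elim!: oddE)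
      then have "y = scl (ell p) c ((T ^^ (2 * k)) (T x))" using y by (simp add: funpow_swap1)
      then show ?thesis by (auto simp: S_def)
    qed
  next
    fix y assume "y \<in> S x \<union> S (T x)"
    then obtain c k where "y = scl (ell p) c ((T ^^ (2 * k)) x) \<or> y = scl (ell p) c ((T ^^ (2 * k)) (T x))"
      unfolding S_def by blast
    then have "y = scl (ell p) c ((T ^^ (2 * k)) x) \<or> y = scl (ell p) c ((T ^^ Suc (2 * k)) x)"
      by (simp only: funpow_Suc_right o_apply)
    then show "y \<in> {scl (ell p) c ((T ^^ n) x) | c n. True}" by blast
  qed
  then have dense: "weakly_dense (ell p) (S x \<union> S (T x))" using x(2) by simp
  have "f s = 0" if "s \<in> S x" for s
    using that f(4) bounded_clinear_scl[OF f(1) funpow_T_mem[OF x(1)]] by (auto simp: S_def scalars_def)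
  moreover have "g s = 0" if "s \<in> S (T x)" for s
    using that g(4) bounded_clinear_scl[OF g(1) funpow_T_mem[OF Tx]] by (auto simp: S_def scalars_def)
  ultimately show False
    using weakly_dense_Un_annihilated[OF f(1) _ g(1) _ dense] f(2,3) g(2,3) by blast
qed

text \<open>
  The functional \<open>(u, v) \<mapsto> \<langle>u, y\<rangle> - \<langle>v, x\<rangle>\<close> kills the orbit of the cyclic vector \<open>(x, y)\<close>. Hence it is
  zero, which forces \<open>x = y = 0\<close>, and the zero vector is not cyclic.
\<close>

lemma cyclic_direct_sum_imp_small_products:
  assumes "cyclic (direct_sum (ell p) (ell p)) (map_prod T T)"
  shows "small_products b"
proof (rule ccontr)
  assume big: "\<not> small_products b"
  let ?B = "direct_sum (ell p) (ell p)"
  interpret P: complex_normed_space ?B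
    by (rule complex_normed_space_direct_sum[OF complex_normed_space_axioms complex_normed_space_axioms])
  obtain x y where xy: "x \<in> vecs (ell p)" "y \<in> vecs (ell p)"
    and dense: "norm_dense ?B (P.vs.span {(map_prod T T ^^ n) (x, y) | n. True})"
    using assms by (auto simp: cyclic_def direct_sum_def)
  obtain q c where c: "c > 0" and le: "\<And>j. c \<le> cmod (b j * b (2 * q - j))"
    using not_small_products_lower_bound[OF big] by metis
  define s where "s = 2 * q"
  define a where "a = (\<lambda>j. 1 / (b j * b (s - j)))"
  have a: "cmod (a j) \<le> 1 / c" for j
    using le[of j] c unfolding a_def norm_divide by (intro frac_le) (auto simp: s_def)
  have lin: "bounded_clinear ?B scalars f" if "bounded_clinear ?B (ell p) g" "v \<in> vecs (ell p)"
    "f = (\<lambda>z. reflected_pairing a s (g z) v)" for f g v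
    unfolding that(3)
    by (rule bounded_clinear_compose[OF P.complex_normed_space_axioms complex_normed_space_axioms that(1)
          bounded_clinear_reflected_pairing[OF p_ge_1 p_le_2 that(2) a]])
  define f where "f z = reflected_pairing a s (fst z) y - reflected_pairing a s (snd z) x" for z
  have f: "bounded_clinear ?B scalars f"
    unfolding f_def
    by (intro bounded_clinear_minus[OF P.complex_normed_space_axioms complex_normed_space_scalars]
        lin[OF _ xy(2) refl] lin[OF _ xy(1) refl] bounded_clinear_fst bounded_clinear_snd
        complex_normed_space_axioms)
  have "f ((map_prod T T ^^ n) (x, y)) = 0" for n
    using reflected_pairing_shift_swap[of "\<lambda>_. 1" s "int n" x y]
    by (simp add: f_def funpow_map_prod funpow_T xy a_def)
  moreover have "(map_prod T T ^^ n) (x, y) \<in> vecs ?B" for n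
    using funpow_T_mem xy by (simp add: funpow_map_prod direct_sum_def)
  ultimately have f0: "f z = 0" if "z \<in> vecs ?B" for z
    by (intro bounded_clinear_eq_0_if_dense_span[OF P.complex_normed_space_axioms complex_normed_space_scalars f dense _ _ that]) auto
  have unit: "unit_seq i \<in> vecs (ell p)" for i using unit_seq_ell(1)[OF p_ge_1] .
  have rp0: "reflected_pairing a' s 0 v = 0" for a' v by (simp add: reflected_pairing_def)
  have "y i = 0" for i
    using f0[of "(unit_seq (s - i), 0)"] unit
    by (simp add: direct_sum_def f_def rp0 reflected_pairing_unit_seq a_def b_nonzero)
  moreover have "x i = 0" for i
    using f0[of "(0, unit_seq (s - i))"] unit
    by (simp add: direct_sum_def f_def rp0 reflected_pairing_unit_seq a_def b_nonzero)
  ultimately have "x = 0" "y = 0" by auto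
  \<comment> \<open>The coordinate \<open>fst z 0\<close> vanishes on the orbit of zero, but not at the first basis vector.\<close>
  have "unit_seq 0 (0::int) = 0"
  proof (rule bounded_clinear_eq_0_if_dense_span[where f = "\<lambda>z. fst z 0" and x = "(unit_seq 0, 0)", simplified])
    show "complex_normed_space ?B" by (rule P.complex_normed_space_axioms)
    show "bounded_clinear ?B scalars (\<lambda>z. fst z 0)"
      by (rule bounded_clinear_compose[OF P.complex_normed_space_axioms complex_normed_space_axioms
            bounded_clinear_fst[OF complex_normed_space_axioms complex_normed_space_axioms] bounded_clinear_coordinate[OF p_ge_1]])
    have "(T ^^ n) 0 = 0" for n using funpow_T[of 0] by (simp add: shift_by_def fun_eq_iff)
    then show "fst z 0 = 0" if "z \<in> {(map_prod T T ^^ n) (x, y) | n. True}" for z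
      using that by (auto simp: funpow_map_prod \<open>x = 0\<close>)
    show "{(map_prod T T ^^ n) (x, y) | n. True} \<subseteq> vecs ?B"
      using funpow_T_mem xy by (auto simp: funpow_map_prod direct_sum_def)
  qed (use dense unit complex_normed_space_scalars in \<open>auto simp: direct_sum_def\<close>)
  then show False by (simp add: unit_seq_def)
qed

end

section \<open>The equivalences\<close>

theorem theorem1p1:
  fixes p :: real and w :: "int \<Rightarrow> complex" and T :: "(int \<Rightarrow> complex) \<Rightarrow> (int \<Rightarrow> complex)"
  assumes "1 \<le> p" and "p \<le> 2" and "weighted_bilateral_shift p w T"
  shows "(supercyclicity_criterion (ell p) T \<longleftrightarrow> supercyclic (ell p) T) \<and>
    (supercyclic (ell p) T \<longleftrightarrow> weakly_supercyclic (ell p) T) \<and>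
    (weakly_supercyclic (ell p) T \<longleftrightarrow> cyclic (direct_sum (ell p) (ell p)) (map_prod T T)) \<and>
    (cyclic (direct_sum (ell p) (ell p)) (map_prod T T) \<longleftrightarrow> (\<exists>n\<ge>2. cyclic (ell p) (T ^^ n))) \<and>
    ((\<exists>n\<ge>2. cyclic (ell p) (T ^^ n)) \<longleftrightarrow> (\<forall>n\<ge>1. cyclic (ell p) (T ^^ n)))"
proof -
  have w: "bounded (range w)" "\<And>n. w n \<noteq> 0"
    using assms(3) by (auto simp: weighted_bilateral_shift_def)
  obtain b where b: "\<And>j. b j \<noteq> 0" "\<And>j. b (j - 1) = w j * b j"
    using exists_shift_profile w(2) by blast
  obtain K' where K': "\<And>n. cmod (w n) \<le> K'" using w(1) by (auto simp: bounded_iff)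
  interpret shift_profile_le_2 p w T b "max 1 K'"
    by unfold_locales (use assms b K' in \<open>auto simp: le_max_iff_disj\<close>)
  let ?B = "direct_sum (ell p) (ell p)"
  have E: "complex_normed_space (ell p)" by (rule complex_normed_space_axioms)
  have EE: "complex_normed_space ?B" by (rule complex_normed_space_direct_sum[OF E E])
  obtain D where D: "countable D" "norm_dense (ell p) D"
    using countable_dense_finsupp[OF assms(1)] by metis
  note complete = mcomplete_ell[OF assms(1)]
  have supercyclic: "supercyclic (ell p) (T ^^ N)" if "supercyclicity_criterion (ell p) (T ^^ N)" for N
    by (rule supercyclicity_criterion_imp_supercyclic[OF E complete D bounded_clinear_funpow[OF E bounded_clinear_T] that])
  have power: "cyclic (ell p) (T ^^ N)" if "small_products b" "N \<ge> 1" for N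
    by (rule supercyclic_imp_cyclic[OF E bounded_clinear_funpow[OF E bounded_clinear_T]
          supercyclic[OF supercyclicity_criterion_power[OF that]]])
  have crit: "supercyclicity_criterion (ell p) T" if "small_products b"
    using supercyclicity_criterion_power[OF that, of 1] by simp
  have sum: "cyclic ?B (map_prod T T)" if "small_products b"
  proof (rule supercyclic_imp_cyclic[OF EE])
    show lin: "bounded_clinear ?B ?B (map_prod T T)"
      by (rule bounded_clinear_map_prod[OF E E bounded_clinear_T bounded_clinear_T])
    show "supercyclic ?B (map_prod T T)"
      by (rule supercyclicity_criterion_imp_supercyclic[OF EE mcomplete_direct_sum[OF E E complete complete] _
            norm_dense_direct_sum[OF E E D(2) D(2)] lin supercyclicity_criterion_direct_sum[OF E crit[OF that]]])
        (use D in auto)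
  qed
  have "supercyclicity_criterion (ell p) T \<longleftrightarrow> small_products b"
    "supercyclic (ell p) T \<longleftrightarrow> small_products b"
    "weakly_supercyclic (ell p) T \<longleftrightarrow> small_products b"
    using crit supercyclic[of 1] supercyclic_imp_weakly_supercyclic weakly_supercyclic_imp_small_products
    by auto
  moreover have "cyclic ?B (map_prod T T) \<longleftrightarrow> small_products b"
    using sum cyclic_direct_sum_imp_small_products by blast
  moreover have "(\<exists>n\<ge>2. cyclic (ell p) (T ^^ n)) \<longleftrightarrow> small_products b"
    using power[of 2] cyclic_power_imp_small_products by (auto intro!: exI[of _ 2])
  moreover have "(\<forall>n\<ge>1. cyclic (ell p) (T ^^ n)) \<longleftrightarrow> small_products b"
    using power cyclic_power_imp_small_products[of 2] by auto
  ultimately show ?thesis by simp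
qed

end
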